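(* Let $\mathcal{T}$ be a triangulated category and $\alpha_1,\dots,\alpha_c$ a sequence of elements of $Z^*(\mathcal{T})$, each $\alpha_i$ induced by an action $\mathsf{F}_i\colon\mathcal{S}_i\times\mathcal{T}\to\mathcal{T}$ of a monoidal triangulated category $\mathcal{S}_i$. If each $\mathsf{F}_i$ admits a strong Verdier structure, then for all objects $X,Y$ of $\mathcal{T}$, \[ \operatorname{level}^X_{\mathcal{T}}\bigl(Y/\!\!/(\alpha_1,\dots,\alpha_c)\bigr)\le\operatorname{level}^X_{\mathcal{T}}(Y)+c . \]
   Context: Graded center: $Z^*(\mathcal{T})=\bigoplus_{d\in\mathbb{Z}}\{\alpha\colon\mathrm{id}_{\mathcal{T}}\to\Sigma^d\text{ natural}:\alpha\Sigma=(-1)^d\Sigma\alpha\}$. Koszul objects: $X/\!\!/\alpha$ is a cone of $\alpha(X)\colon X\to\Sigma^{|\alpha|}X$ and $X/\!\!/(\alpha_1,\dots,\alpha_c)=(X/\!\!/(\alpha_1,\dots,\alpha_{c-1}))/\!\!/\alpha_c$. Biexact functor $\mathsf{F}\colon\mathcal{S}\times\mathcal{T}\to\mathcal{U}$: bifunctor with natural isomorphisms $\theta\colon\mathsf{F}(\Sigma-,-)\to\Sigma\mathsf{F}$, $\zeta\colon\mathsf{F}(-,\Sigma-)\to\Sigma\mathsf{F}$ making $\mathsf{F}(X,-)$ (with $\zeta$) and $\mathsf{F}(-,X')$ (with $\theta$) exact, with $(\Sigma\zeta)\theta=-(\Sigma\theta)\zeta$ on $\mathsf{F}(\Sigma X,\Sigma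 X')$. A monoidal triangulated category $(\mathcal{S},\otimes,\mathbb{1})$: triangulated category with a monoidal structure whose product is biexact and whose associativity/unit isomorphisms are natural transformations of exact functors in each variable. An action on $\mathcal{T}$: biexact $\mathsf{F}\colon\mathcal{S}\times\mathcal{T}\to\mathcal{T}$ with natural isomorphisms $\mathsf{F}(X,\mathsf{F}(Y,Z))\cong\mathsf{F}(X\otimes Y,Z)$, $\lambda\colon\mathsf{F}(\mathbb{1},Z)\cong Z$, natural transformations of exact functors in each variable satisfying module coherence. $\alpha$ is induced by $\mathsf{F}$ if $\alpha=\alpha_f$ for some $f\colon\mathbb{1}\to\Sigma^n\mathbb{1}$, where $\alpha_f(X)=\theta\circ\mathsf{F}(f,X)\circ\lambda^{-1}\colon X\to\Sigma^nX$. Homotopy cartesian square ($g\colon T\to V$, $f\colon T\to U$, $f'\colon V\to P$, $g'\colon U\to P$, commutative): there is an exact triangle $T\xrightarrow{\binom{f}{-g}}U\oplus V\xrightarrow{(g'\ f')}P\to\Sigma T$. Strong Verdier structure for biexact $\mathsf{F}$: for all exact triangles $X\xrightarrow{f}Y\xrightarrow{g}Z\xrightarrow{h}\Sigma X$, $X'\xrightarrow{f'}Y'\xrightarrow{g'}Z'\xrightarrow{h'}\Sigma X'$ there exist $W$ and exact triangles $\mathsf{F}(X,Y')\xrightarrow{j}W\xrightarrow{q}\mathsf{F}(Z,X')\xrightarrow{\theta\mathsf{F}(h,f')}\Sigma\mathsf{F}(X,Y')$, $W\xrightarrow{i}\mathsf{F}(Y,Y')\xrightarrow{\mathsf{F}(g,g')}\mathsf{F}(Z,Z')\xrightarrow{p}\Sigma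 W$, $\mathsf{F}(Y,X')\xrightarrow{j'}W\xrightarrow{q'}\mathsf{F}(X,Z')\xrightarrow{\zeta\mathsf{F}(f,h')}\Sigma\mathsf{F}(Y,X')$ with $q'j=\mathsf{F}(X,g')$, $ij=\mathsf{F}(f,Y')$, $ij'=\mathsf{F}(Y,f')$, $qj'=\mathsf{F}(g,X')$, $(\Sigma q)p=\zeta\mathsf{F}(Z,h')$, $(\Sigma q')p=\theta\mathsf{F}(h,Z')$, and commutative homotopy cartesian squares: (I) $j'\mathsf{F}(f,X')=j\mathsf{F}(X,f')$; (II) $\mathsf{F}(g,Y')i=\mathsf{F}(Z,f')q$; (III) $\mathsf{F}(Y,g')i=\mathsf{F}(f,Z')q'$; (IV) $p\mathsf{F}(Z,g')=(\Sigma j)\theta\mathsf{F}(h,Y')$; (V) $p\mathsf{F}(g,Z')=(\Sigma j')\zeta\mathsf{F}(Y,h')$; and (VI) the square $\Sigma(\zeta\mathsf{F}(X,h'))\circ\Sigma q'$ vs. $\Sigma(\theta\mathsf{F}(h,X'))\circ\Sigma q$ from $\Sigma W$ to $\Sigma^2\mathsf{F}(X,X')$ anti-commutes and is homotopy cartesian after negating one of its morphisms. Level: $\operatorname{thick}^0(X)$ = zero objects; $\operatorname{thick}^1(X)$ = smallest full subcategory containing $X$ closed under (de)suspension, finite coproducts, retracts; for $n\ge2$, $Y\in\operatorname{thick}^n(X)$ iff there is an exact triangle $Y'\to Y\oplus\tilde Y\to Y''\to\Sigma Y'$ with $Y'\in\operatorname{thick}^1(X)$, $Y''\in\operatorname{thick}^{n-1}(X)$;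 $\operatorname{level}^X(Y)=\inf\{n\ge0:Y\in\operatorname{thick}^n(X)\}$. *)

theory Defs
  imports Main "HOL-Library.Extended_Nat"
begin

record ('o,'m) tcat =
  Ob  :: "'o set"
  Hom :: "'o \<Rightarrow> 'o \<Rightarrow> 'm set"
  cmp :: "'m \<Rightarrow> 'm \<Rightarrow> 'm"      (* cmp C g f = g o f *)
  idm :: "'o \<Rightarrow> 'm"
  pls :: "'m \<Rightarrow> 'm \<Rightarrow> 'm"
  ngt :: "'m \<Rightarrow> 'm"
  zro :: "'o \<Rightarrow> 'o \<Rightarrow> 'm"
  SO  :: "'o \<Rightarrow> 'o"              (* suspension on objects *)
  SM  :: "'m \<Rightarrow> 'm"              (* suspension on morphisms *)
  SOi :: "'o \<Rightarrow> 'o"              (* inverse suspension *)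
  SMi :: "'m \<Rightarrow> 'm"
  Tri :: "('o \<times> 'o \<times> 'o \<times> 'm \<times> 'm \<times> 'm) set"   (* exact triangles (X,Y,Z,f,g,h) *)

definition category :: "('o,'m) tcat \<Rightarrow> bool" where
  "category C \<longleftrightarrow>
     (\<forall>x y. (x \<notin> Ob C \<or> y \<notin> Ob C) \<longrightarrow> Hom C x y = {}) \<and>
     (\<forall>x y x' y'. (x,y) \<noteq> (x',y') \<longrightarrow> Hom C x y \<inter> Hom C x' y' = {}) \<and>
     (\<forall>x\<in>Ob C. idm C x \<in> Hom C x x) \<and>
     (\<forall>x y z f g. f \<in> Hom C x y \<longrightarrow> g \<in> Hom C y z \<longrightarrow> cmp C g f \<in> Hom C x z) \<and>
     (\<forall>x y f. f \<in> Hom C x y \<longrightarrow> cmp C (idm C y) f = f \<and> cmp C f (idm C x) = f) \<and>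
     (\<forall>w x y z f g h. f \<in> Hom C w x \<longrightarrow> g \<in> Hom C x y \<longrightarrow> h \<in> Hom C y z \<longrightarrow>
        cmp C h (cmp C g f) = cmp C (cmp C h g) f)"

definition is_zero :: "('o,'m) tcat \<Rightarrow> 'o \<Rightarrow> bool" where
  "is_zero C z \<longleftrightarrow> z \<in> Ob C \<and> (\<forall>x\<in>Ob C. Hom C z x = {zro C z x} \<and> Hom C x z = {zro C x z})"

definition is_biprod :: "('o,'m) tcat \<Rightarrow> 'o \<Rightarrow> 'o \<Rightarrow> 'o \<Rightarrow> 'm \<Rightarrow> 'm \<Rightarrow> 'm \<Rightarrow> 'm \<Rightarrow> bool" where
  "is_biprod C b x y i1 i2 p1 p2 \<longleftrightarrow> b \<in> Ob C \<and>
     i1 \<in> Hom C x b \<and> i2 \<in> Hom C y b \<and> p1 \<in> Hom C b x \<and> p2 \<in> Hom C b y \<and>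
     cmp C p1 i1 = idm C x \<and> cmp C p2 i2 = idm C y \<and>
     cmp C p1 i2 = zro C y x \<and> cmp C p2 i1 = zro C x y \<and>
     pls C (cmp C i1 p1) (cmp C i2 p2) = idm C b"

definition additive :: "('o,'m) tcat \<Rightarrow> bool" where
  "additive C \<longleftrightarrow> category C \<and>
     (\<forall>x\<in>Ob C. \<forall>y\<in>Ob C. zro C x y \<in> Hom C x y \<and>
        (\<forall>f\<in>Hom C x y. \<forall>g\<in>Hom C x y. pls C f g \<in> Hom C x y \<and> pls C f g = pls C g f) \<and>
        (\<forall>f\<in>Hom C x y. \<forall>g\<in>Hom C x y. \<forall>h\<in>Hom C x y. pls C (pls C f g) h = pls C f (pls C g h)) \<and>
        (\<forall>f\<in>Hom C x y. pls C f (zro C x y) = f \<and> ngt C f \<in> Hom C x y \<and> pls C f (ngt C f) = zro C x y)) \<and>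
     (\<forall>x y z f g g'. f \<in> Hom C x y \<longrightarrow> g \<in> Hom C y z \<longrightarrow> g' \<in> Hom C y z \<longrightarrow>
        cmp C (pls C g g') f = pls C (cmp C g f) (cmp C g' f)) \<and>
     (\<forall>x y z f f' g. f \<in> Hom C x y \<longrightarrow> f' \<in> Hom C x y \<longrightarrow> g \<in> Hom C y z \<longrightarrow>
        cmp C g (pls C f f') = pls C (cmp C g f) (cmp C g f')) \<and>
     (\<exists>z. is_zero C z) \<and>
     (\<forall>x\<in>Ob C. \<forall>y\<in>Ob C. \<exists>b i1 i2 p1 p2. is_biprod C b x y i1 i2 p1 p2)"

definition susp_auto :: "('o,'m) tcat \<Rightarrow> bool" where
  "susp_auto C \<longleftrightarrow>
     (\<forall>x\<in>Ob C. SO C x \<in> Ob C \<and> SOi C x \<in> Ob C \<and> SOi C (SO C x) = x \<and> SO C (SOi C x) = x) \<and>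
     (\<forall>x y f. f \<in> Hom C x y \<longrightarrow> SM C f \<in> Hom C (SO C x) (SO C y) \<and> SMi C f \<in> Hom C (SOi C x) (SOi C y)
        \<and> SMi C (SM C f) = f \<and> SM C (SMi C f) = f) \<and>
     (\<forall>x\<in>Ob C. SM C (idm C x) = idm C (SO C x)) \<and>
     (\<forall>x y z f g. f \<in> Hom C x y \<longrightarrow> g \<in> Hom C y z \<longrightarrow> SM C (cmp C g f) = cmp C (SM C g) (SM C f)) \<and>
     (\<forall>x y f g. f \<in> Hom C x y \<longrightarrow> g \<in> Hom C x y \<longrightarrow> SM C (pls C f g) = pls C (SM C f) (SM C g))"

definition isoC :: "('o,'m) tcat \<Rightarrow> 'o \<Rightarrow> 'o \<Rightarrow> 'm \<Rightarrow> bool" where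
  "isoC C x y f \<longleftrightarrow> f \<in> Hom C x y \<and> (\<exists>g\<in>Hom C y x. cmp C g f = idm C x \<and> cmp C f g = idm C y)"

definition inv_of :: "('o,'m) tcat \<Rightarrow> 'o \<Rightarrow> 'o \<Rightarrow> 'm \<Rightarrow> 'm" where
  "inv_of C x y f = (SOME g. g \<in> Hom C y x \<and> cmp C g f = idm C x \<and> cmp C f g = idm C y)"

definition wf_tri :: "('o,'m) tcat \<Rightarrow> ('o \<times> 'o \<times> 'o \<times> 'm \<times> 'm \<times> 'm) \<Rightarrow> bool" where
  "wf_tri C t = (case t of (X,Y,Z,f,g,h) \<Rightarrow>
     f \<in> Hom C X Y \<and> g \<in> Hom C Y Z \<and> h \<in> Hom C Z (SO C X))"

definition tri_iso :: "('o,'m) tcat \<Rightarrow> ('o \<times> 'o \<times> 'o \<times> 'm \<times> 'm \<times> 'm) \<Rightarrow> ('o \<times> 'o \<times> 'o \<times> 'm \<times> 'm \<times> 'm) \<Rightarrow> bool" where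
  "tri_iso C t t' = (case t of (X,Y,Z,f,g,h) \<Rightarrow> case t' of (X',Y',Z',f',g',h') \<Rightarrow>
     (\<exists>a b c. isoC C X X' a \<and> isoC C Y Y' b \<and> isoC C Z Z' c \<and>
        cmp C b f = cmp C f' a \<and> cmp C c g = cmp C g' b \<and> cmp C (SM C a) h = cmp C h' c))"

definition triangulated :: "('o,'m) tcat \<Rightarrow> bool" where
  "triangulated C \<longleftrightarrow> additive C \<and> susp_auto C \<and>
     (\<forall>t\<in>Tri C. wf_tri C t) \<and>
     (\<forall>t t'. t \<in> Tri C \<longrightarrow> wf_tri C t' \<longrightarrow> tri_iso C t t' \<longrightarrow> t' \<in> Tri C) \<and>
     (\<forall>X\<in>Ob C. \<forall>z. is_zero C z \<longrightarrow> (X, X, z, idm C X, zro C X z, zro C z (SO C X)) \<in> Tri C) \<and>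
     (\<forall>X Y f. f \<in> Hom C X Y \<longrightarrow> (\<exists>Z g h. (X,Y,Z,f,g,h) \<in> Tri C)) \<and>
     (\<forall>X Y Z f g h. (X,Y,Z,f,g,h) \<in> Tri C \<longleftrightarrow> (Y, Z, SO C X, g, h, ngt C (SM C f)) \<in> Tri C) \<and>
     (\<forall>X Y Z f g h X' Y' Z' f' g' h' a b. (X,Y,Z,f,g,h) \<in> Tri C \<longrightarrow> (X',Y',Z',f',g',h') \<in> Tri C \<longrightarrow>
        a \<in> Hom C X X' \<longrightarrow> b \<in> Hom C Y Y' \<longrightarrow> cmp C b f = cmp C f' a \<longrightarrow>
        (\<exists>c\<in>Hom C Z Z'. cmp C c g = cmp C g' b \<and> cmp C (SM C a) h = cmp C h' c)) \<and>
     (\<forall>X Y Z Z' X' Y' u v j k l i m n.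
        (X,Y,Z',u,j,k) \<in> Tri C \<longrightarrow> (Y,Z,X',v,l,i) \<in> Tri C \<longrightarrow> (X,Z,Y',cmp C v u,m,n) \<in> Tri C \<longrightarrow>
        (\<exists>f g. (Z',Y',X',f,g,cmp C (SM C j) i) \<in> Tri C \<and> cmp C f j = cmp C m v \<and> cmp C g m = l \<and>
               cmp C n f = k \<and> cmp C (SM C u) n = cmp C i g))"

definition SOp :: "('o,'m) tcat \<Rightarrow> int \<Rightarrow> 'o \<Rightarrow> 'o" where
  "SOp C d x = (if 0 \<le> d then (SO C ^^ nat d) x else (SOi C ^^ nat (- d)) x)"

definition SMp :: "('o,'m) tcat \<Rightarrow> int \<Rightarrow> 'm \<Rightarrow> 'm" where
  "SMp C d f = (if 0 \<le> d then (SM C ^^ nat d) f else (SMi C ^^ nat (- d)) f)"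

record ('a,'b,'c,'d,'e,'f) bifun =
  fo :: "'a \<Rightarrow> 'c \<Rightarrow> 'e"
  fm :: "'b \<Rightarrow> 'd \<Rightarrow> 'f"
  th :: "'a \<Rightarrow> 'c \<Rightarrow> 'f"    (* theta : F(Sigma X, X') -> Sigma F(X,X') *)
  ze :: "'a \<Rightarrow> 'c \<Rightarrow> 'f"    (* zeta  : F(X, Sigma X') -> Sigma F(X,X') *)

definition bifunctor :: "('a,'b) tcat \<Rightarrow> ('c,'d) tcat \<Rightarrow> ('e,'f) tcat \<Rightarrow> ('a,'b,'c,'d,'e,'f) bifun \<Rightarrow> bool" where
  "bifunctor S T U F \<longleftrightarrow>
     (\<forall>X\<in>Ob S. \<forall>X'\<in>Ob T. fo F X X' \<in> Ob U) \<and>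
     (\<forall>X Y X' Y' f g. f \<in> Hom S X Y \<longrightarrow> g \<in> Hom T X' Y' \<longrightarrow> fm F f g \<in> Hom U (fo F X X') (fo F Y Y')) \<and>
     (\<forall>X\<in>Ob S. \<forall>X'\<in>Ob T. fm F (idm S X) (idm T X') = idm U (fo F X X')) \<and>
     (\<forall>X Y Z X' Y' Z' f1 f2 g1 g2. f1 \<in> Hom S X Y \<longrightarrow> f2 \<in> Hom S Y Z \<longrightarrow> g1 \<in> Hom T X' Y' \<longrightarrow> g2 \<in> Hom T Y' Z' \<longrightarrow>
        fm F (cmp S f2 f1) (cmp T g2 g1) = cmp U (fm F f2 g2) (fm F f1 g1))"

definition bl :: "('a,'b,'c,'d,'e,'f) bifun \<Rightarrow> ('c,'d) tcat \<Rightarrow> 'b \<Rightarrow> 'c \<Rightarrow> 'f" where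
  "bl F T f X' = fm F f (idm T X')"

definition br :: "('a,'b,'c,'d,'e,'f) bifun \<Rightarrow> ('a,'b) tcat \<Rightarrow> 'a \<Rightarrow> 'd \<Rightarrow> 'f" where
  "br F S X g = fm F (idm S X) g"

definition biexact :: "('a,'b) tcat \<Rightarrow> ('c,'d) tcat \<Rightarrow> ('e,'f) tcat \<Rightarrow> ('a,'b,'c,'d,'e,'f) bifun \<Rightarrow> bool" where
  "biexact S T U F \<longleftrightarrow> bifunctor S T U F \<and>
     (\<forall>X\<in>Ob S. \<forall>X'\<in>Ob T.
        isoC U (fo F (SO S X) X') (SO U (fo F X X')) (th F X X') \<and>
        isoC U (fo F X (SO T X')) (SO U (fo F X X')) (ze F X X')) \<and>
     (\<forall>X Y X' Y' f g. f \<in> Hom S X Y \<longrightarrow> g \<in> Hom T X' Y' \<longrightarrow>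
        cmp U (th F Y Y') (fm F (SM S f) g) = cmp U (SM U (fm F f g)) (th F X X') \<and>
        cmp U (ze F Y Y') (fm F f (SM T g)) = cmp U (SM U (fm F f g)) (ze F X X')) \<and>
     (\<forall>X\<in>Ob S. \<forall>A B D u v w. (A,B,D,u,v,w) \<in> Tri T \<longrightarrow>
        (fo F X A, fo F X B, fo F X D, br F S X u, br F S X v, cmp U (ze F X A) (br F S X w)) \<in> Tri U) \<and>
     (\<forall>X'\<in>Ob T. \<forall>A B D u v w. (A,B,D,u,v,w) \<in> Tri S \<longrightarrow>
        (fo F A X', fo F B X', fo F D X', bl F T u X', bl F T v X', cmp U (th F A X') (bl F T w X')) \<in> Tri U) \<and>
     (\<forall>X\<in>Ob S. \<forall>X'\<in>Ob T.
        cmp U (SM U (ze F X X')) (th F X (SO T X')) = ngt U (cmp U (SM U (th F X X')) (ze F (SO S X) X')))"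

record ('o,'m) moncat =
  tens :: "('o,'m,'o,'m,'o,'m) bifun"
  one  :: 'o
  asc  :: "'o \<Rightarrow> 'o \<Rightarrow> 'o \<Rightarrow> 'm"   (* (X*Y)*Z -> X*(Y*Z) *)
  lu   :: "'o \<Rightarrow> 'm"               (* 1*X -> X *)
  ru   :: "'o \<Rightarrow> 'm"               (* X*1 -> X *)

definition monoidal_tri :: "('o,'m) tcat \<Rightarrow> ('o,'m) moncat \<Rightarrow> bool" where
  "monoidal_tri S M \<longleftrightarrow> triangulated S \<and> biexact S S S (tens M) \<and> one M \<in> Ob S \<and>
   (let tO = fo (tens M); tM = fm (tens M); thM = th (tens M); zeM = ze (tens M); I = one M;
        a = asc M; l = lu M; r = ru M; c = cmp S; i = idm S in
     (\<forall>X\<in>Ob S. \<forall>Y\<in>Ob S. \<forall>Z\<in>Ob S. isoC S (tO (tO X Y) Z) (tO X (tO Y Z)) (a X Y Z)) \<and>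
     (\<forall>X\<in>Ob S. isoC S (tO I X) X (l X) \<and> isoC S (tO X I) X (r X)) \<and>
     (\<forall>X Y Z X' Y' Z' f g h. f \<in> Hom S X X' \<longrightarrow> g \<in> Hom S Y Y' \<longrightarrow> h \<in> Hom S Z Z' \<longrightarrow>
        c (a X' Y' Z') (tM (tM f g) h) = c (tM f (tM g h)) (a X Y Z)) \<and>
     (\<forall>X Y f. f \<in> Hom S X Y \<longrightarrow> c (l Y) (tM (i I) f) = c f (l X) \<and> c (r Y) (tM f (i I)) = c f (r X)) \<and>
     (\<forall>X\<in>Ob S. \<forall>Y\<in>Ob S. \<forall>Z\<in>Ob S. \<forall>W\<in>Ob S.
        c (a X Y (tO Z W)) (a (tO X Y) Z W) = c (tM (i X) (a Y Z W)) (c (a X (tO Y Z) W) (tM (a X Y Z) (i W)))) \<and>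
     (\<forall>X\<in>Ob S. \<forall>Y\<in>Ob S. c (tM (i X) (l Y)) (a X I Y) = tM (r X) (i Y)) \<and>
     (\<forall>X\<in>Ob S. \<forall>Y\<in>Ob S. \<forall>Z\<in>Ob S.
        c (SM S (a X Y Z)) (c (thM (tO X Y) Z) (tM (thM X Y) (i Z))) = c (thM X (tO Y Z)) (a (SO S X) Y Z) \<and>
        c (SM S (a X Y Z)) (c (thM (tO X Y) Z) (tM (zeM X Y) (i Z)))
          = c (zeM X (tO Y Z)) (c (tM (i X) (thM Y Z)) (a X (SO S Y) Z)) \<and>
        c (SM S (a X Y Z)) (zeM (tO X Y) Z) = c (zeM X (tO Y Z)) (c (tM (i X) (zeM Y Z)) (a X Y (SO S Z)))) \<and>
     (\<forall>X\<in>Ob S. c (SM S (l X)) (zeM I X) = l (SO S X) \<and> c (SM S (r X)) (thM X I) = r (SO S X)))"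

record ('so,'sm,'to,'tm) action =
  act :: "('so,'sm,'to,'tm,'to,'tm) bifun"
  mu  :: "'so \<Rightarrow> 'so \<Rightarrow> 'to \<Rightarrow> 'tm"   (* F(X,F(Y,Z)) -> F(X*Y,Z) *)
  lam :: "'to \<Rightarrow> 'tm"                 (* F(1,Z) -> Z *)

definition is_action :: "('so,'sm) tcat \<Rightarrow> ('so,'sm) moncat \<Rightarrow> ('to,'tm) tcat \<Rightarrow> ('so,'sm,'to,'tm) action \<Rightarrow> bool" where
  "is_action S M T A \<longleftrightarrow> biexact S T T (act A) \<and>
   (let Fo = fo (act A); Fm = fm (act A); thF = th (act A); zeF = ze (act A);
        tO = fo (tens M); tM = fm (tens M); thM = th (tens M); zeM = ze (tens M); I = one M;
        m = mu A; lz = lam A; c = cmp T; iS = idm S; iT = idm T in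
     (\<forall>X\<in>Ob S. \<forall>Y\<in>Ob S. \<forall>Z\<in>Ob T. isoC T (Fo X (Fo Y Z)) (Fo (tO X Y) Z) (m X Y Z)) \<and>
     (\<forall>Z\<in>Ob T. isoC T (Fo I Z) Z (lz Z)) \<and>
     (\<forall>X Y Z X' Y' Z' f g h. f \<in> Hom S X X' \<longrightarrow> g \<in> Hom S Y Y' \<longrightarrow> h \<in> Hom T Z Z' \<longrightarrow>
        c (m X' Y' Z') (Fm f (Fm g h)) = c (Fm (tM f g) h) (m X Y Z)) \<and>
     (\<forall>Z Z' h. h \<in> Hom T Z Z' \<longrightarrow> c (lz Z') (Fm (iS I) h) = c h (lz Z)) \<and>
     (\<forall>X\<in>Ob S. \<forall>Y\<in>Ob S. \<forall>Z\<in>Ob T.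
        c (SM T (m X Y Z)) (thF X (Fo Y Z)) = c (thF (tO X Y) Z) (c (Fm (thM X Y) (iT Z)) (m (SO S X) Y Z)) \<and>
        c (SM T (m X Y Z)) (c (zeF X (Fo Y Z)) (Fm (iS X) (thF Y Z)))
          = c (thF (tO X Y) Z) (c (Fm (zeM X Y) (iT Z)) (m X (SO S Y) Z)) \<and>
        c (SM T (m X Y Z)) (c (zeF X (Fo Y Z)) (Fm (iS X) (zeF Y Z))) = c (zeF (tO X Y) Z) (m X Y (SO T Z))) \<and>
     (\<forall>Z\<in>Ob T. c (SM T (lz Z)) (zeF I Z) = lz (SO T Z)) \<and>
     (\<forall>X\<in>Ob S. \<forall>Y\<in>Ob S. \<forall>W\<in>Ob S. \<forall>Z\<in>Ob T.
        c (m X (tO Y W) Z) (Fm (iS X) (m Y W Z)) = c (Fm (asc M X Y W) (iT Z)) (c (m (tO X Y) W Z) (m X Y (Fo W Z)))) \<and>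
     (\<forall>X\<in>Ob S. \<forall>Z\<in>Ob T. c (Fm (ru M X) (iT Z)) (m X I Z) = Fm (iS X) (lz Z)) \<and>
     (\<forall>Y\<in>Ob S. \<forall>Z\<in>Ob T. c (Fm (lu M Y) (iT Z)) (m I Y Z) = lz (Fo Y Z)))"

definition central :: "('o,'m) tcat \<Rightarrow> int \<Rightarrow> ('o \<Rightarrow> 'm) \<Rightarrow> bool" where
  "central C d \<alpha> \<longleftrightarrow>
     (\<forall>X\<in>Ob C. \<alpha> X \<in> Hom C X (SOp C d X)) \<and>
     (\<forall>X Y f. f \<in> Hom C X Y \<longrightarrow> cmp C (\<alpha> Y) f = cmp C (SMp C d f) (\<alpha> X)) \<and>
     (\<forall>X\<in>Ob C. \<alpha> (SO C X) = (if even d then SM C (\<alpha> X) else ngt C (SM C (\<alpha> X))))"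

fun thpn :: "('a,'b) tcat \<Rightarrow> ('e,'f) tcat \<Rightarrow> ('a,'b,'c,'d,'e,'f) bifun \<Rightarrow> nat \<Rightarrow> 'a \<Rightarrow> 'c \<Rightarrow> 'f" where
  "thpn S U F 0 Y X' = idm U (fo F Y X')"
| "thpn S U F (Suc n) Y X' = cmp U (SM U (thpn S U F n Y X')) (th F ((SO S ^^ n) Y) X')"

definition thp :: "('a,'b) tcat \<Rightarrow> ('e,'f) tcat \<Rightarrow> ('a,'b,'c,'d,'e,'f) bifun \<Rightarrow> int \<Rightarrow> 'a \<Rightarrow> 'c \<Rightarrow> 'f" where
  "thp S U F d Y X' = (if 0 \<le> d then thpn S U F (nat d) Y X'
     else inv_of U (SOp U d (fo F Y X')) (fo F (SOp S d Y) X')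
            ((SMi U ^^ nat (- d)) (thpn S U F (nat (- d)) (SOp S d Y) X')))"

definition induced :: "('so,'sm) tcat \<Rightarrow> ('so,'sm) moncat \<Rightarrow> ('to,'tm) tcat \<Rightarrow> ('so,'sm,'to,'tm) action
    \<Rightarrow> int \<Rightarrow> ('to \<Rightarrow> 'tm) \<Rightarrow> bool" where
  "induced S M T A d \<alpha> \<longleftrightarrow>
     (\<exists>f \<in> Hom S (one M) (SOp S d (one M)). \<forall>X\<in>Ob T.
        \<alpha> X = cmp T (SMp T d (lam A X))
                 (cmp T (thp S T (act A) d (one M) X)
                   (cmp T (fm (act A) f (idm T X)) (inv_of T (fo (act A) (one M) X) X (lam A X)))))"

definition hcart :: "('o,'m) tcat \<Rightarrow> 'o \<Rightarrow> 'o \<Rightarrow> 'o \<Rightarrow> 'o \<Rightarrow> 'm \<Rightarrow> 'm \<Rightarrow> 'm \<Rightarrow> 'm \<Rightarrow> bool" where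
  "hcart C T0 U V P f g f' g' \<longleftrightarrow>
     f \<in> Hom C T0 U \<and> g \<in> Hom C T0 V \<and> f' \<in> Hom C V P \<and> g' \<in> Hom C U P \<and>
     cmp C g' f = cmp C f' g \<and>
     (\<exists>B i1 i2 p1 p2 h. is_biprod C B U V i1 i2 p1 p2 \<and>
        (T0, B, P, pls C (cmp C i1 f) (cmp C i2 (ngt C g)), pls C (cmp C g' p1) (cmp C f' p2), h) \<in> Tri C)"

definition strong_verdier :: "('a,'b) tcat \<Rightarrow> ('c,'d) tcat \<Rightarrow> ('e,'f) tcat \<Rightarrow> ('a,'b,'c,'d,'e,'f) bifun \<Rightarrow> bool" where
  "strong_verdier S T U F \<longleftrightarrow>
   (\<forall>X Y Z f g h X' Y' Z' f' g' h'. (X,Y,Z,f,g,h) \<in> Tri S \<longrightarrow> (X',Y',Z',f',g',h') \<in> Tri T \<longrightarrow>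
    (let Fo = fo F; Fm = fm F; c = cmp U; \<Sigma> = SM U; L = (\<lambda>u A. bl F T u A); R = (\<lambda>A u. br F S A u) in
     (\<exists>W j q i p j' q'. W \<in> Ob U \<and>
       (Fo X Y', W, Fo Z X', j, q, c (th F X Y') (Fm h f')) \<in> Tri U \<and>
       (W, Fo Y Y', Fo Z Z', i, Fm g g', p) \<in> Tri U \<and>
       (Fo Y X', W, Fo X Z', j', q', c (ze F Y X') (Fm f h')) \<in> Tri U \<and>
       c q' j = R X g' \<and> c i j = L f Y' \<and> c i j' = R Y f' \<and> c q j' = L g X' \<and>
       c (\<Sigma> q) p = c (ze F Z X') (R Z h') \<and> c (\<Sigma> q') p = c (th F X Z') (L h Z') \<and>
       hcart U (Fo X X') (Fo Y X') (Fo X Y') W (L f X') (R X f') j j' \<and>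
       hcart U W (Fo Y Y') (Fo Z X') (Fo Z Y') i q (R Z f') (L g Y') \<and>
       hcart U W (Fo Y Y') (Fo X Z') (Fo Y Z') i q' (L f Z') (R Y g') \<and>
       hcart U (Fo Z Y') (Fo Z Z') (SO U (Fo X Y')) (SO U W) (R Z g') (c (th F X Y') (L h Y')) (\<Sigma> j) p \<and>
       hcart U (Fo Y Z') (Fo Z Z') (SO U (Fo Y X')) (SO U W) (L g Z') (c (ze F Y X') (R Y h')) (\<Sigma> j') p \<and>
       hcart U (SO U W) (SO U (Fo X Z')) (SO U (Fo Z X')) (SO U (SO U (Fo X X')))
         (\<Sigma> q') (\<Sigma> q) (ngt U (\<Sigma> (c (th F X X') (L h X')))) (\<Sigma> (c (ze F X X') (R X h'))))))"

inductive_set thick1 :: "('o,'m) tcat \<Rightarrow> 'o \<Rightarrow> 'o set" for C X where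
  base: "X \<in> Ob C \<Longrightarrow> X \<in> thick1 C X"
| susp: "Y \<in> thick1 C X \<Longrightarrow> SO C Y \<in> thick1 C X"
| desusp: "Y \<in> thick1 C X \<Longrightarrow> SOi C Y \<in> thick1 C X"
| zero: "is_zero C Z \<Longrightarrow> Z \<in> thick1 C X"
| sum: "Y1 \<in> thick1 C X \<Longrightarrow> Y2 \<in> thick1 C X \<Longrightarrow> is_biprod C B Y1 Y2 i1 i2 p1 p2 \<Longrightarrow> B \<in> thick1 C X"
| retr: "Y \<in> thick1 C X \<Longrightarrow> W \<in> Ob C \<Longrightarrow> i \<in> Hom C W Y \<Longrightarrow> p \<in> Hom C Y W \<Longrightarrow>
         cmp C p i = idm C W \<Longrightarrow> W \<in> thick1 C X"

fun thick :: "('o,'m) tcat \<Rightarrow> 'o \<Rightarrow> nat \<Rightarrow> 'o set" where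
  "thick C X 0 = {Z. is_zero C Z}"
| "thick C X (Suc 0) = thick1 C X"
| "thick C X (Suc (Suc n)) = {Y \<in> Ob C. \<exists>Yt B i1 i2 p1 p2 Y1 Y2 a b c.
      is_biprod C B Y Yt i1 i2 p1 p2 \<and> Y1 \<in> thick1 C X \<and> Y2 \<in> thick C X (Suc n) \<and>
      (Y1, B, Y2, a, b, c) \<in> Tri C}"

definition level :: "('o,'m) tcat \<Rightarrow> 'o \<Rightarrow> 'o \<Rightarrow> enat" where
  "level C X Y = (INF n \<in> {n. Y \<in> thick C X n}. enat n)"

text \<open>koszul C Y als K: K is (a choice of) the Koszul object Y//(alpha_1,...,alpha_c),
  where als lists the pairs (degree, alpha).\<close>

inductive koszul :: "('o,'m) tcat \<Rightarrow> 'o \<Rightarrow> (int \<times> ('o \<Rightarrow> 'm)) list \<Rightarrow> 'o \<Rightarrow> bool" for C Y where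
  nil: "Y \<in> Ob C \<Longrightarrow> koszul C Y [] Y"
| snoc: "koszul C Y as K \<Longrightarrow> (K, SOp C d K, L, \<alpha> K, g, h) \<in> Tri C \<Longrightarrow> koszul C Y (as @ [(d, \<alpha>)]) L"

end

theory Submission
  imports Defs
begin

text \<open>
  Induction on \<open>n\<close> shows more than the claim for one
  element: if \<open>A\<close> has level at most \<open>n\<close> and \<open>A'\<close> has level at most \<open>1\<close>, then every cone \<open>W\<close> of a map
  \<open>(\<alpha>, u): A \<rightarrow> \<Sigma>\<^sup>dA \<oplus> A'\<close> has level at most \<open>n + 1\<close>. Up to retracts there is a triangle
  \<open>Y1 \<rightarrow> A \<rightarrow> Y2 \<rightarrow> \<Sigma>Y1\<close> with maps \<open>a, b, c\<close>, where \<open>Y1\<close> has level at most \<open>1\<close> and \<open>Y2\<close> level at most \<open>n - 1\<close>.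
  By the octahedral axiom a cone \<open>V\<close> of \<open>(\<alpha>, c): Y2 \<rightarrow> \<Sigma>\<^sup>dY2 \<oplus> \<Sigma>Y1\<close> is also a cone of
  \<open>\<alpha> b = (\<Sigma>\<^sup>db) \<alpha>: A \<rightarrow> \<Sigma>\<^sup>dY2\<close>, and a second octahedron gives a triangle \<open>\<Sigma>\<^sup>dY1 \<oplus> A' \<rightarrow> W \<rightarrow> V \<rightarrow>\<close>,
  in which \<open>V\<close> has level at most \<open>n\<close> by induction. The Koszul object is the case \<open>A' = 0\<close>.
\<close>

section \<open>Categories with abelian groups of morphisms\<close>

locale triangulated_category =
  fixes C :: "('o,'m) tcat"
  assumes tri: "triangulated C"
begin

abbreviation comp :: "'m \<Rightarrow> 'm \<Rightarrow> 'm" (infixl "\<cdot>" 70)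
  where "g \<cdot> f \<equiv> cmp C g f"
abbreviation plus_mor :: "'m \<Rightarrow> 'm \<Rightarrow> 'm" (infixl "\<^bold>+" 65)
  where "f \<^bold>+ g \<equiv> pls C f g"

lemma additiveC: "additive C" and susp_autoC: "susp_auto C"
  using tri by (simp_all add: triangulated_def)

lemma categoryC: "category C"
  using additiveC by (simp add: additive_def)

lemmas category_laws = categoryC[unfolded category_def, THEN conjunct2, THEN conjunct2]

lemma Hom_Ob: "f \<in> Hom C x y \<Longrightarrow> x \<in> Ob C \<and> y \<in> Ob C"
  using categoryC[unfolded category_def, THEN conjunct1] by blast

lemma Hom_dom: "f \<in> Hom C x y \<Longrightarrow> x \<in> Ob C"
  and Hom_cod: "f \<in> Hom C x y \<Longrightarrow> y \<in> Ob C"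
  using Hom_Ob by blast+

lemma id_in [intro, simp]: "x \<in> Ob C \<Longrightarrow> idm C x \<in> Hom C x x"
  using category_laws by blast

lemma comp_in [intro]: "g \<in> Hom C y z \<Longrightarrow> f \<in> Hom C x y \<Longrightarrow> g \<cdot> f \<in> Hom C x z"
  using category_laws[THEN conjunct2, THEN conjunct1] by blast

lemma id_left [simp]: "f \<in> Hom C x y \<Longrightarrow> idm C y \<cdot> f = f"
  and id_right [simp]: "f \<in> Hom C x y \<Longrightarrow> f \<cdot> idm C x = f"
  using category_laws[THEN conjunct2, THEN conjunct2, THEN conjunct1] by blast+

lemma comp_assoc:
  "f \<in> Hom C w x \<Longrightarrow> g \<in> Hom C x y \<Longrightarrow> h \<in> Hom C y z \<Longrightarrow> h \<cdot> (g \<cdot> f) = h \<cdot> g \<cdot> f"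
  using category_laws[THEN conjunct2, THEN conjunct2, THEN conjunct2] by blast

lemmas group_laws = additiveC[unfolded additive_def, THEN conjunct2, THEN conjunct1, rule_format]

lemma zro_in [intro, simp]: "x \<in> Ob C \<Longrightarrow> y \<in> Ob C \<Longrightarrow> zro C x y \<in> Hom C x y"
  using group_laws by blast

lemma
  assumes f: "f \<in> Hom C x y"
  shows pls_in [intro]: "g \<in> Hom C x y \<Longrightarrow> f \<^bold>+ g \<in> Hom C x y"
    and pls_commute: "g \<in> Hom C x y \<Longrightarrow> f \<^bold>+ g = g \<^bold>+ f"
    and pls_assoc: "g \<in> Hom C x y \<Longrightarrow> h \<in> Hom C x y \<Longrightarrow> f \<^bold>+ g \<^bold>+ h = f \<^bold>+ (g \<^bold>+ h)"
    and pls_zro [simp]: "f \<^bold>+ zro C x y = f"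
    and ngt_in [intro]: "ngt C f \<in> Hom C x y"
    and pls_ngt: "f \<^bold>+ ngt C f = zro C x y"
  using group_laws[OF Hom_dom[OF f] Hom_cod[OF f]] f by blast+

lemma zro_pls [simp]: "f \<in> Hom C x y \<Longrightarrow> zro C x y \<^bold>+ f = f"
  by (metis Hom_Ob pls_commute pls_zro zro_in)

lemma comp_pls_left:
  "f \<in> Hom C x y \<Longrightarrow> g \<in> Hom C y z \<Longrightarrow> g' \<in> Hom C y z \<Longrightarrow> (g \<^bold>+ g') \<cdot> f = g \<cdot> f \<^bold>+ g' \<cdot> f"
  using additiveC[unfolded additive_def, THEN conjunct2, THEN conjunct2, THEN conjunct1] by blast

lemma comp_pls_right:
  "f \<in> Hom C x y \<Longrightarrow> f' \<in> Hom C x y \<Longrightarrow> g \<in> Hom C y z \<Longrightarrow> g \<cdot> (f \<^bold>+ f') = g \<cdot> f \<^bold>+ g \<cdot> f'"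
  using additiveC[unfolded additive_def, THEN conjunct2, THEN conjunct2, THEN conjunct2, THEN conjunct1]
  by blast

lemma pls_left_cancel:
  assumes f: "f \<in> Hom C x y" and "g \<in> Hom C x y" "h \<in> Hom C x y" "f \<^bold>+ g = f \<^bold>+ h"
  shows "g = h"
proof -
  have "ngt C f \<^bold>+ f = zro C x y" using pls_commute[OF ngt_in[OF f] f] pls_ngt[OF f] by simp
  then have "ngt C f \<^bold>+ (f \<^bold>+ k) = k" if "k \<in> Hom C x y" for k
    using pls_assoc[OF ngt_in[OF f] f that] zro_pls[OF that] by simp
  then show ?thesis using assms by metis
qed

lemma ngt_unique:
  assumes "f \<in> Hom C x y" "g \<in> Hom C x y" "f \<^bold>+ g = zro C x y"
  shows "g = ngt C f"
  using assms pls_left_cancel pls_ngt by (metis ngt_in)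

lemma ngt_ngt [simp]: "f \<in> Hom C x y \<Longrightarrow> ngt C (ngt C f) = f"
  by (metis ngt_in ngt_unique pls_commute pls_ngt)

lemma eq_if_diff_zro:
  assumes "f \<in> Hom C x y" "g \<in> Hom C x y" "f \<^bold>+ ngt C g = zro C x y"
  shows "f = g"
  using assms by (metis ngt_in ngt_ngt ngt_unique pls_commute)

lemma zro_comp [simp]:
  assumes "f \<in> Hom C x y" "z \<in> Ob C"
  shows "zro C y z \<cdot> f = zro C x z"
proof -
  have z: "zro C y z \<in> Hom C y z" using assms Hom_cod by blast
  have "zro C y z \<cdot> f \<^bold>+ zro C y z \<cdot> f = zro C y z \<cdot> f \<^bold>+ zro C x z"
    using comp_pls_left[OF assms(1) z z] z assms by (metis comp_in pls_zro)
  then show ?thesis using z assms by (meson comp_in Hom_dom pls_left_cancel zro_in)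
qed

lemma comp_zro [simp]:
  assumes "g \<in> Hom C y z" "x \<in> Ob C"
  shows "g \<cdot> zro C x y = zro C x z"
proof -
  have z: "zro C x y \<in> Hom C x y" using assms Hom_dom by blast
  have "g \<cdot> zro C x y \<^bold>+ g \<cdot> zro C x y = g \<cdot> zro C x y \<^bold>+ zro C x z"
    using comp_pls_right[OF z z assms(1)] z assms by (metis comp_in pls_zro)
  then show ?thesis using z assms by (meson comp_in Hom_cod pls_left_cancel zro_in)
qed

lemma ngt_zro [simp]: "x \<in> Ob C \<Longrightarrow> y \<in> Ob C \<Longrightarrow> ngt C (zro C x y) = zro C x y"
  using ngt_unique[of "zro C x y" x y "zro C x y"] by simp

lemma comp_ngt_left:
  assumes f: "f \<in> Hom C x y" and g: "g \<in> Hom C y z"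
  shows "ngt C g \<cdot> f = ngt C (g \<cdot> f)"
proof (rule ngt_unique)
  show "g \<cdot> f \<^bold>+ ngt C g \<cdot> f = zro C x z"
    using comp_pls_left[OF f g ngt_in[OF g]] pls_ngt[OF g] zro_comp[OF f Hom_cod[OF g]] by simp
qed (use assms in blast)+

lemma comp_ngt_right:
  assumes f: "f \<in> Hom C x y" and g: "g \<in> Hom C y z"
  shows "g \<cdot> ngt C f = ngt C (g \<cdot> f)"
proof (rule ngt_unique)
  show "g \<cdot> f \<^bold>+ g \<cdot> ngt C f = zro C x z"
    using comp_pls_right[OF f ngt_in[OF f] g] pls_ngt[OF f] comp_zro[OF g Hom_dom[OF f]] by simp
qed (use assms in blast)+

lemma comp_diff_left:
  assumes f: "f \<in> Hom C x y" and "g \<in> Hom C y z" "g' \<in> Hom C y z"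
  shows "(g \<^bold>+ ngt C g') \<cdot> f = g \<cdot> f \<^bold>+ ngt C (g' \<cdot> f)"
  using comp_pls_left[OF f] comp_ngt_left[OF f] assms ngt_in by metis

lemma comp_diff_right:
  assumes "f \<in> Hom C x y" "f' \<in> Hom C x y" and g: "g \<in> Hom C y z"
  shows "g \<cdot> (f \<^bold>+ ngt C f') = g \<cdot> f \<^bold>+ ngt C (g \<cdot> f')"
  using comp_pls_right[OF _ _ g] comp_ngt_right[OF _ g] assms ngt_in by metis

lemma diff_pls:
  assumes f: "f \<in> Hom C x y" and g: "g \<in> Hom C x y"
  shows "f \<^bold>+ ngt C g \<^bold>+ g = f"
  using pls_assoc[OF f ngt_in[OF g] g] pls_commute[OF ngt_in[OF g] g] pls_ngt[OF g] f by simp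

section \<open>The suspension as an additive automorphism\<close>

lemma SO_Ob [intro, simp]: "x \<in> Ob C \<Longrightarrow> SO C x \<in> Ob C"
  and SOi_Ob [intro, simp]: "x \<in> Ob C \<Longrightarrow> SOi C x \<in> Ob C"
  and SOi_SO [simp]: "x \<in> Ob C \<Longrightarrow> SOi C (SO C x) = x"
  and SO_SOi [simp]: "x \<in> Ob C \<Longrightarrow> SO C (SOi C x) = x"
  using susp_autoC[unfolded susp_auto_def, THEN conjunct1] by blast+

lemma SM_in [intro]: "f \<in> Hom C x y \<Longrightarrow> SM C f \<in> Hom C (SO C x) (SO C y)"
  and SMi_in [intro]: "f \<in> Hom C x y \<Longrightarrow> SMi C f \<in> Hom C (SOi C x) (SOi C y)"
  and SMi_SM [simp]: "f \<in> Hom C x y \<Longrightarrow> SMi C (SM C f) = f"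
  and SM_SMi [simp]: "f \<in> Hom C x y \<Longrightarrow> SM C (SMi C f) = f"
  using susp_autoC[unfolded susp_auto_def, THEN conjunct2, THEN conjunct1] by blast+

lemmas susp_laws = susp_autoC[unfolded susp_auto_def, THEN conjunct2, THEN conjunct2]

lemma SM_id [simp]: "x \<in> Ob C \<Longrightarrow> SM C (idm C x) = idm C (SO C x)"
  using susp_laws[THEN conjunct1] by blast

lemma SM_comp: "f \<in> Hom C x y \<Longrightarrow> g \<in> Hom C y z \<Longrightarrow> SM C (g \<cdot> f) = SM C g \<cdot> SM C f"
  using susp_laws[THEN conjunct2, THEN conjunct1] by blast

lemma SM_pls: "f \<in> Hom C x y \<Longrightarrow> g \<in> Hom C x y \<Longrightarrow> SM C (f \<^bold>+ g) = SM C f \<^bold>+ SM C g"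
  using susp_laws[THEN conjunct2, THEN conjunct2] by blast

lemma SM_inj: "f \<in> Hom C x y \<Longrightarrow> g \<in> Hom C x' y' \<Longrightarrow> SM C f = SM C g \<Longrightarrow> f = g"
  by (metis SMi_SM)

lemma SM_zro [simp]:
  assumes "x \<in> Ob C" "y \<in> Ob C"
  shows "SM C (zro C x y) = zro C (SO C x) (SO C y)"
proof -
  have "SM C (zro C x y) \<^bold>+ SM C (zro C x y) = SM C (zro C x y) \<^bold>+ zro C (SO C x) (SO C y)"
    using SM_pls[of "zro C x y" x y "zro C x y"] assms by (metis SM_in pls_zro zro_in)
  then show ?thesis using assms by (meson SM_in SO_Ob pls_left_cancel zro_in)
qed

lemma SM_ngt: "f \<in> Hom C x y \<Longrightarrow> SM C (ngt C f) = ngt C (SM C f)"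
  using SM_pls[of f x y "ngt C f"] SM_zro[of x y] pls_ngt[of f x y] ngt_in[of f x y] Hom_Ob[of f x y]
  by (intro ngt_unique[of _ "SO C x" "SO C y"]) auto

lemma SMi_id: "x \<in> Ob C \<Longrightarrow> SMi C (idm C x) = idm C (SOi C x)"
  by (metis SM_id SMi_SM SO_SOi SOi_Ob id_in)

lemma SMi_comp:
  assumes "f \<in> Hom C x y" "g \<in> Hom C y z"
  shows "SMi C (g \<cdot> f) = SMi C g \<cdot> SMi C f"
proof -
  note f = SMi_in[OF assms(1)] and g = SMi_in[OF assms(2)]
  have "SM C (SMi C g \<cdot> SMi C f) = g \<cdot> f" using SM_comp[OF f g] assms by simp
  then show ?thesis using SMi_SM[OF comp_in[OF g f]] by simp
qed

section \<open>Exact triangles: rotation, fill-ins, weak kernels and cokernels\<close>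

lemmas triangle_laws = tri[unfolded triangulated_def, THEN conjunct2, THEN conjunct2]

lemma Tri_Hom:
  assumes "(X,Y,Z,f,g,h) \<in> Tri C"
  shows "f \<in> Hom C X Y" "g \<in> Hom C Y Z" "h \<in> Hom C Z (SO C X)"
  using bspec[OF triangle_laws[THEN conjunct1] assms] by (simp_all add: wf_tri_def)

lemma Tri_Ob:
  assumes "(X,Y,Z,f,g,h) \<in> Tri C"
  shows "X \<in> Ob C" "Y \<in> Ob C" "Z \<in> Ob C"
  using Tri_Hom[OF assms] Hom_Ob by blast+

lemma Tri_iso_closed:
  assumes "(X,Y,Z,f,g,h) \<in> Tri C"
    and "f' \<in> Hom C X' Y'" "g' \<in> Hom C Y' Z'" "h' \<in> Hom C Z' (SO C X')"
    and "isoC C X X' a" "isoC C Y Y' b" "isoC C Z Z' c"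
    and "b \<cdot> f = f' \<cdot> a" "c \<cdot> g = g' \<cdot> b" "SM C a \<cdot> h = h' \<cdot> c"
  shows "(X',Y',Z',f',g',h') \<in> Tri C"
proof -
  have "wf_tri C (X',Y',Z',f',g',h')" using assms by (simp add: wf_tri_def)
  moreover have "tri_iso C (X,Y,Z,f,g,h) (X',Y',Z',f',g',h')"
    using assms by (auto simp: tri_iso_def)
  ultimately show ?thesis using assms(1) triangle_laws[THEN conjunct2, THEN conjunct1] by blast
qed

lemma Tri_id: "x \<in> Ob C \<Longrightarrow> is_zero C z \<Longrightarrow> (x, x, z, idm C x, zro C x z, zro C z (SO C x)) \<in> Tri C"
  using triangle_laws[THEN conjunct2, THEN conjunct2, THEN conjunct1] by blast

lemma Tri_cone:
  assumes "f \<in> Hom C X Y"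
  obtains Z g h where "(X,Y,Z,f,g,h) \<in> Tri C"
  using assms triangle_laws[THEN conjunct2, THEN conjunct2, THEN conjunct2, THEN conjunct1] by blast

lemma Tri_rot_iff: "(X,Y,Z,f,g,h) \<in> Tri C \<longleftrightarrow> (Y, Z, SO C X, g, h, ngt C (SM C f)) \<in> Tri C"
  using triangle_laws[THEN conjunct2, THEN conjunct2, THEN conjunct2, THEN conjunct2, THEN conjunct1] by blast

lemmas Tri_rot = Tri_rot_iff[THEN iffD1]

text \<open>The sign on the first map cancels the sign that rotating forward puts on its
  suspension.\<close>

lemma Tri_rot_back:
  assumes "(X,Y,Z,f,g,h) \<in> Tri C"
  shows "(SOi C Z, X, Y, ngt C (SMi C h), f, g) \<in> Tri C"
proof -
  note O = Tri_Ob[OF assms] and H = Tri_Hom[OF assms]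
  have "SMi C h \<in> Hom C (SOi C Z) X" using SMi_in[OF H(3)] O by simp
  then have "ngt C (SM C (ngt C (SMi C h))) = h"
    using H(3) by (metis SM_SMi SM_ngt ngt_ngt)
  then show ?thesis using assms O by (subst Tri_rot_iff) simp
qed

lemma Tri_map:
  assumes "(X,Y,Z,f,g,h) \<in> Tri C" "(X',Y',Z',f',g',h') \<in> Tri C"
    and "a \<in> Hom C X X'" "b \<in> Hom C Y Y'" "b \<cdot> f = f' \<cdot> a"
  obtains c where "c \<in> Hom C Z Z'" "c \<cdot> g = g' \<cdot> b" "SM C a \<cdot> h = h' \<cdot> c"
  using assms triangle_laws[THEN conjunct2, THEN conjunct2, THEN conjunct2, THEN conjunct2,
      THEN conjunct2, THEN conjunct1] by metis

lemma octahedral: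
  assumes "(X,Y,Z',u,j,k) \<in> Tri C" "(Y,Z,X',v,l,i) \<in> Tri C" "(X,Z,Y',v \<cdot> u,m,n) \<in> Tri C"
  obtains f g where "(Z',Y',X',f,g,SM C j \<cdot> i) \<in> Tri C" "f \<cdot> j = m \<cdot> v" "g \<cdot> m = l"
    "n \<cdot> f = k" "SM C u \<cdot> n = i \<cdot> g"
  using assms triangle_laws[THEN conjunct2, THEN conjunct2, THEN conjunct2, THEN conjunct2,
      THEN conjunct2, THEN conjunct2] by metis

lemma zero_exists: obtains z where "is_zero C z"
  using additiveC[unfolded additive_def, THEN conjunct2, THEN conjunct2, THEN conjunct2,
      THEN conjunct2, THEN conjunct1] by blast

lemma is_zero_Ob: "is_zero C z \<Longrightarrow> z \<in> Ob C"
  by (simp add: is_zero_def)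

lemma Hom_zero_source: "is_zero C z \<Longrightarrow> f \<in> Hom C z x \<Longrightarrow> f = zro C z x"
  using Hom_Ob unfolding is_zero_def by blast

text \<open>The pair (identity, \<open>f\<close>) extends to a map from the trivial triangle on
  \<open>X\<close>. Its third component starts at a zero object, and \<open>g \<cdot> f\<close>
  factors through that object.\<close>

lemma Tri_comp_zro:
  assumes "(X,Y,Z,f,g,h) \<in> Tri C"
  shows "g \<cdot> f = zro C X Z"
proof -
  note O = Tri_Ob[OF assms] and H = Tri_Hom[OF assms]
  obtain z where z: "is_zero C z" by (rule zero_exists)
  obtain c where c: "c \<in> Hom C z Z" "c \<cdot> zro C X z = g \<cdot> f"
    by (rule Tri_map[OF Tri_id[OF O(1) z] assms, of "idm C X" f]) (use O H in auto)
  then show ?thesis using O by simp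
qed

text \<open>A fill-in from the given triangle to the backward rotation of the trivial triangle on
  \<open>D\<close>, whose second map is the identity of \<open>D\<close>.\<close>

lemma Tri_weak_cokernel:
  assumes "(X,Y,Z,f,g,h) \<in> Tri C" "k \<in> Hom C Y D" "k \<cdot> f = zro C X D"
  obtains m where "m \<in> Hom C Z D" "m \<cdot> g = k"
proof -
  note O = Tri_Ob[OF assms(1)] and H = Tri_Hom[OF assms(1)]
  have D: "D \<in> Ob C" using assms(2) Hom_cod by blast
  obtain z where z: "is_zero C z" by (rule zero_exists)
  note zO = is_zero_Ob[OF z]
  obtain e where t: "(SOi C z, D, D, e, idm C D, zro C D z) \<in> Tri C"
    using Tri_rot_back[OF Tri_id[OF D z]] by blast
  \<comment> \<open>After suspension the source of \<open>e\<close> is \<open>z\<close> itself, so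
    \<open>SM C e\<close> is zero, and \<open>SM C\<close> is injective on morphisms.\<close>
  have "e = zro C (SOi C z) D"
  proof -
    have "e \<in> Hom C (SOi C z) D" using Tri_Hom[OF t] by blast
    moreover from this have "SM C e = SM C (zro C (SOi C z) D)"
      using Hom_zero_source[OF z, of "SM C e"] SM_in[of e "SOi C z" D] zO D by simp
    ultimately show ?thesis using zO D by (meson SM_inj SOi_Ob zro_in)
  qed
  then have "k \<cdot> f = e \<cdot> zro C X (SOi C z)" 
    using assms comp_zro[OF zro_in[OF SOi_Ob[OF zO] D] O(1)] by simp
  then obtain c where "c \<in> Hom C Z D" "c \<cdot> g = idm C D \<cdot> k"
    using Tri_map[OF assms(1) t, of "zro C X (SOi C z)" k] assms(2) O zO by blast
  then show ?thesis using that assms(2) by simp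
qed

text \<open>Both the trivial triangle on \<open>D\<close> and the given one are rotated once, so
  that \<open>k\<close> becomes the first component of a map of triangles. The fill-in then runs
  from \<open>SO C D\<close> to \<open>SO C X\<close>, and its desuspension is the required
  lift.\<close>

lemma Tri_weak_kernel:
  assumes "(X,Y,Z,f,g,h) \<in> Tri C" "k \<in> Hom C D Y" "g \<cdot> k = zro C D Z"
  obtains m where "m \<in> Hom C D X" "f \<cdot> m = k"
proof -
  note O = Tri_Ob[OF assms(1)] and H = Tri_Hom[OF assms(1)]
  have D: "D \<in> Ob C" using assms(2) Hom_dom by blast
  obtain z where z: "is_zero C z" by (rule zero_exists)
  note zO = is_zero_Ob[OF z]
  have "zro C z Z \<cdot> zro C D z = g \<cdot> k" using assms O D zO by simp
  then obtain c where c: "c \<in> Hom C (SO C D) (SO C X)"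
    "SM C k \<cdot> ngt C (SM C (idm C D)) = ngt C (SM C f) \<cdot> c"
    using Tri_map[OF Tri_rot[OF Tri_id[OF D z]] Tri_rot[OF assms(1)], of k "zro C z Z"]
      assms(2) O zO by blast
  have k: "SM C k \<in> Hom C (SO C D) (SO C Y)" and f: "SM C f \<in> Hom C (SO C X) (SO C Y)"
    using assms(2) H(1) by blast+
  have "ngt C (SM C k) = ngt C (SM C f \<cdot> c)"
    using c k f D by (metis SM_id SO_Ob comp_ngt_left comp_ngt_right id_in id_right)
  then have *: "SM C k = SM C f \<cdot> c" using k f c(1) by (metis comp_in ngt_ngt)
  have m: "SMi C c \<in> Hom C D X" using SMi_in[OF c(1)] D O by simp
  have "SM C (f \<cdot> SMi C c) = SM C k" using * SM_comp[OF m H(1)] c(1) by simp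
  then have "f \<cdot> SMi C c = k" using m H(1) assms(2) by (meson SM_inj comp_in)
  then show ?thesis using that m by blast
qed

section \<open>Biproducts, split triangles and endomorphisms of triangles\<close>

lemma biprodD:
  assumes "is_biprod C b x y i1 i2 p1 p2"
  shows "b \<in> Ob C" "x \<in> Ob C" "y \<in> Ob C" "i1 \<in> Hom C x b" "i2 \<in> Hom C y b" "p1 \<in> Hom C b x" "p2 \<in> Hom C b y"
    "p1 \<cdot> i1 = idm C x" "p2 \<cdot> i2 = idm C y" "p1 \<cdot> i2 = zro C y x" "p2 \<cdot> i1 = zro C x y"
    "i1 \<cdot> p1 \<^bold>+ i2 \<cdot> p2 = idm C b"
  using assms Hom_Ob unfolding is_biprod_def by blast+

lemma biprod_exists:
  assumes "x \<in> Ob C" "y \<in> Ob C"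
  obtains b i1 i2 p1 p2 where "is_biprod C b x y i1 i2 p1 p2"
  using assms additiveC[unfolded additive_def, THEN conjunct2, THEN conjunct2, THEN conjunct2,
      THEN conjunct2, THEN conjunct2] by blast

lemma biprod_swap:
  assumes "is_biprod C b x y i1 i2 p1 p2"
  shows "is_biprod C b y x i2 i1 p2 p1"
proof -
  note B = biprodD[OF assms]
  have "i1 \<cdot> p1 \<in> Hom C b b" "i2 \<cdot> p2 \<in> Hom C b b" using B by blast+
  then show ?thesis using B pls_commute unfolding is_biprod_def by metis
qed

text \<open>Allows a map into a single object to be treated as a map into a biproduct whose second
  summand is zero.\<close>

lemma biprod_zero:
  assumes "x \<in> Ob C" "is_zero C z"
  shows "is_biprod C x x z (idm C x) (zro C z x) (idm C x) (zro C x z)"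
proof -
  note z = is_zero_Ob[OF assms(2)]
  have "zro C z z = idm C z" using Hom_zero_source[OF assms(2) id_in[OF z]] by simp
  moreover have "zro C x z \<cdot> zro C z x = zro C z z" using comp_zro[OF zro_in[OF assms(1) z] z] .
  moreover have "idm C x \<cdot> idm C x = idm C x" using id_left[OF id_in[OF assms(1)]] .
  moreover have "idm C x \<^bold>+ zro C z x \<cdot> zro C x z = idm C x"
    unfolding comp_zro[OF zro_in[OF z assms(1)] assms(1)] using pls_zro[OF id_in[OF assms(1)]] .
  ultimately show ?thesis using assms(1) z by (simp add: is_biprod_def)
qed

lemma biprod_eqI:
  assumes "is_biprod C b x y i1 i2 p1 p2" "m \<in> Hom C a b" "m' \<in> Hom C a b"
    and "p1 \<cdot> m = p1 \<cdot> m'" "p2 \<cdot> m = p2 \<cdot> m'"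
  shows "m = m'"
proof -
  note B = biprodD[OF assms(1)]
  have "n = i1 \<cdot> (p1 \<cdot> n) \<^bold>+ i2 \<cdot> (p2 \<cdot> n)" if n: "n \<in> Hom C a b" for n
  proof -
    have "(i1 \<cdot> p1 \<^bold>+ i2 \<cdot> p2) \<cdot> n = (i1 \<cdot> p1) \<cdot> n \<^bold>+ (i2 \<cdot> p2) \<cdot> n"
      using n B by (blast intro: comp_pls_left)
    then show ?thesis using n B by (simp add: comp_assoc[OF n])
  qed
  then show ?thesis using assms by metis
qed

lemma biprod_pair:
  assumes "is_biprod C b x y i1 i2 p1 p2" "s \<in> Hom C a x" "t \<in> Hom C a y"
  obtains m where "m \<in> Hom C a b" "p1 \<cdot> m = s" "p2 \<cdot> m = t"
proof -
  note B = biprodD[OF assms(1)]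
  have a: "a \<in> Ob C" using assms(2) Hom_dom by blast
  have H: "i1 \<cdot> s \<in> Hom C a b" "i2 \<cdot> t \<in> Hom C a b" using B assms by blast+
  have "p1 \<cdot> (i1 \<cdot> s \<^bold>+ i2 \<cdot> t) = s"
    using H B assms a by (simp add: comp_pls_right[OF H B(6)] comp_assoc[OF assms(2) B(4,6)]
        comp_assoc[OF assms(3) B(5,6)])
  moreover have "p2 \<cdot> (i1 \<cdot> s \<^bold>+ i2 \<cdot> t) = t"
    using H B assms a by (simp add: comp_pls_right[OF H B(7)] comp_assoc[OF assms(2) B(4,7)]
        comp_assoc[OF assms(3) B(5,7)])
  ultimately show ?thesis using that H by blast
qed

text \<open>By rotation \<open>SM C f\<close> annihilates \<open>h\<close>, and
  \<open>SM C p\<close> is a left inverse of \<open>SM C f\<close>.\<close>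

lemma Tri_split_mono_third:
  assumes "(X,Y,Z,f,g,h) \<in> Tri C" and p: "p \<in> Hom C Y X" "p \<cdot> f = idm C X"
  shows "h = zro C Z (SO C X)"
proof -
  note O = Tri_Ob[OF assms(1)] and H = Tri_Hom[OF assms(1)]
  have f: "ngt C (SM C f) \<in> Hom C (SO C X) (SO C Y)" using H by blast
  have "SM C p \<cdot> ngt C (SM C f) = ngt C (idm C (SO C X))"
    using comp_ngt_right[OF SM_in[OF H(1)] SM_in[OF p(1)]] SM_comp[OF H(1) p(1)] p(2) O by simp
  then have "SM C p \<cdot> (ngt C (SM C f) \<cdot> h) = ngt C h"
    using comp_assoc[OF H(3) f SM_in[OF p(1)]] comp_ngt_left[OF H(3) id_in] H(3) O by simp
  then have "ngt C h = zro C Z (SO C X)"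
    using Tri_comp_zro[OF Tri_rot[OF Tri_rot[OF assms(1)]]] comp_zro[OF SM_in[OF p(1)] O(3)] by simp
  then show ?thesis using ngt_ngt[OF H(3)] O by simp
qed

text \<open>Whatever \<open>f\<close> annihilates factors through the desuspension of the zero third
  map, so \<open>f\<close> is a monomorphism. The identity of \<open>Z\<close> lifts along
  \<open>g\<close> to a section \<open>s\<close>, and \<open>1 - s g\<close> is killed by
  \<open>g\<close>, hence equals \<open>f r\<close> for some \<open>r\<close>. Cancelling
  \<open>f\<close> yields \<open>r f = 1\<close> and \<open>r s = 0\<close>.\<close>

lemma Tri_split:
  assumes "(X,Y,Z,f,g,zro C Z (SO C X)) \<in> Tri C"
  obtains r s where "is_biprod C Y X Z f s r g"
proof -
  note O = Tri_Ob[OF assms] and H = Tri_Hom[OF assms]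
  have mono: "k = k'" if k: "k \<in> Hom C D X" "k' \<in> Hom C D X" "f \<cdot> k = f \<cdot> k'" for D k k'
  proof -
    have d: "k \<^bold>+ ngt C k' \<in> Hom C D X" using k by blast
    have "f \<cdot> (k \<^bold>+ ngt C k') = zro C D Y"
      using comp_diff_right[OF k(1,2) H(1)] k(3) pls_ngt[OF comp_in[OF H(1) k(2)]] by simp
    then obtain m where m: "m \<in> Hom C D (SOi C Z)" "ngt C (SMi C (zro C Z (SO C X))) \<cdot> m = k \<^bold>+ ngt C k'"
      using Tri_weak_kernel[OF Tri_rot_back[OF assms] d] by blast
    have "SMi C (zro C Z (SO C X)) = zro C (SOi C Z) X"
      using O SMi_SM[OF zro_in[OF SOi_Ob[OF O(3)] O(1)]] by simp
    then have "k \<^bold>+ ngt C k' = zro C D X" using m O by simp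
    then show ?thesis using k eq_if_diff_zro by blast
  qed
  obtain s where s: "s \<in> Hom C Z Y" "g \<cdot> s = idm C Z"
    by (rule Tri_weak_kernel[OF Tri_rot[OF assms], of "idm C Z" Z]) (use O in auto)
  have sg: "s \<cdot> g \<in> Hom C Y Y" and d: "idm C Y \<^bold>+ ngt C (s \<cdot> g) \<in> Hom C Y Y"
    using s H O by blast+
  have gsg: "g \<cdot> (s \<cdot> g) = g" using s H comp_assoc[OF H(2) s(1) H(2)] by simp
  have "g \<cdot> (idm C Y \<^bold>+ ngt C (s \<cdot> g)) = zro C Y Z"
    using comp_diff_right[OF id_in sg H(2)] gsg pls_ngt[OF H(2)] H O by simp
  then obtain r where r: "r \<in> Hom C Y X" "f \<cdot> r = idm C Y \<^bold>+ ngt C (s \<cdot> g)"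
    using Tri_weak_kernel[OF assms d] by blast
  have sum: "f \<cdot> r \<^bold>+ s \<cdot> g = idm C Y" using r diff_pls[OF id_in sg] O by simp
  have gf: "g \<cdot> f = zro C X Z" by (rule Tri_comp_zro[OF assms])
  have "f \<cdot> (r \<cdot> f) = f \<^bold>+ ngt C (s \<cdot> g \<cdot> f)"
    using comp_diff_left[OF H(1) id_in sg] comp_assoc[OF H(1) r(1) H(1)] r(2) H O by simp
  also have "s \<cdot> g \<cdot> f = zro C X Y" using comp_assoc[OF H(1,2) s(1)] gf s O by simp
  finally have "f \<cdot> (r \<cdot> f) = f \<cdot> idm C X" using H O by simp
  then have rf: "r \<cdot> f = idm C X" using mono[of "r \<cdot> f" X "idm C X"] H r O by blast
  have "f \<cdot> (r \<cdot> s) = s \<^bold>+ ngt C (s \<cdot> g \<cdot> s)"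
    using comp_diff_left[OF s(1) id_in sg] comp_assoc[OF s(1) r(1) H(1)] r(2) s(1) O by simp
  also have "s \<cdot> g \<cdot> s = s" using comp_assoc[OF s(1) H(2) s(1)] s by simp
  finally have "f \<cdot> (r \<cdot> s) = f \<cdot> zro C Z X" using pls_ngt[OF s(1)] H O by simp
  then have "r \<cdot> s = zro C Z X" using mono[of "r \<cdot> s" Z] s r O by blast
  then show ?thesis using that s r sum gf rf H O unfolding is_biprod_def by blast
qed

text \<open>The complement is a cone of \<open>i\<close>, since the third map of the cone triangle
  vanishes.\<close>

lemma split_mono_complement:
  assumes "i \<in> Hom C R B" "p \<in> Hom C B R" "p \<cdot> i = idm C R"
  obtains Q j r q where "is_biprod C B R Q i j r q"
proof -
  obtain Q q h where t: "(R,B,Q,i,q,h) \<in> Tri C" using assms(1) by (rule Tri_cone)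
  then have "(R,B,Q,i,q,zro C Q (SO C R)) \<in> Tri C"
    using Tri_split_mono_third[OF t assms(2,3)] by simp
  then show ?thesis using that by (rule Tri_split)
qed

lemma isoC_id: "x \<in> Ob C \<Longrightarrow> isoC C x x (idm C x)"
  unfolding isoC_def by (metis id_in id_left)

text \<open>A cone \<open>Q\<close> of \<open>i1\<close> is compared with \<open>y\<close>. As
  \<open>p2\<close> kills \<open>i1\<close>, it factors as \<open>c \<cdot> g\<close>, and
  \<open>d = g \<cdot> i2\<close> is inverse to \<open>c\<close>: the difference
  \<open>1 - d c\<close> kills \<open>g\<close>, so it factors through \<open>h = 0\<close>.\<close>

lemma biprod_Tri:
  assumes "is_biprod C b x y i1 i2 p1 p2"
  shows "(x, b, y, i1, p2, zro C y (SO C x)) \<in> Tri C"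
proof -
  note B = biprodD[OF assms]
  obtain Q g h where t: "(x,b,Q,i1,g,h) \<in> Tri C" using B(4) by (rule Tri_cone)
  note O = Tri_Ob[OF t] and H = Tri_Hom[OF t]
  have h: "h = zro C Q (SO C x)" using Tri_split_mono_third[OF t B(6,8)] .
  obtain c where c: "c \<in> Hom C Q y" "c \<cdot> g = p2"
    using Tri_weak_cokernel[OF t B(7)] B(11) by blast
  define d where "d = g \<cdot> i2"
  have d: "d \<in> Hom C y Q" using H B d_def by blast
  have cd: "c \<cdot> d = idm C y" using comp_assoc[OF B(5) H(2) c(1)] c(2) B(9) d_def by simp
  have "d \<cdot> c \<cdot> g = g"
  proof -
    have "g = g \<cdot> (i1 \<cdot> p1 \<^bold>+ i2 \<cdot> p2)" using H B by simp
    also have "\<dots> = g \<cdot> (i1 \<cdot> p1) \<^bold>+ g \<cdot> (i2 \<cdot> p2)"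
      using B H by (blast intro: comp_pls_right)
    also have "g \<cdot> (i1 \<cdot> p1) = zro C b Q"
      using Tri_comp_zro[OF t] comp_assoc[OF B(6,4) H(2)] zro_comp[OF B(6) O(3)] by simp
    also have "g \<cdot> (i2 \<cdot> p2) = d \<cdot> p2" using comp_assoc[OF B(7,5) H(2)] d_def by simp
    also have "\<dots> = d \<cdot> c \<cdot> g" using comp_assoc[OF H(2) c(1) d] c(2) by simp
    also have "zro C b Q \<^bold>+ d \<cdot> c \<cdot> g = d \<cdot> c \<cdot> g" using d c H by (meson comp_in zro_pls)
    finally show ?thesis by simp
  qed
  then have "(idm C Q \<^bold>+ ngt C (d \<cdot> c)) \<cdot> g = zro C b Q"
    using comp_diff_left[OF H(2) id_in comp_in[OF d c(1)]] pls_ngt[OF H(2)] H O by simp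
  moreover have e: "idm C Q \<^bold>+ ngt C (d \<cdot> c) \<in> Hom C Q Q" using d c O by blast
  ultimately obtain m where "m \<in> Hom C (SO C x) Q" "m \<cdot> h = idm C Q \<^bold>+ ngt C (d \<cdot> c)"
    using Tri_weak_cokernel[OF Tri_rot[OF t]] by blast
  then have "idm C Q \<^bold>+ ngt C (d \<cdot> c) = zro C Q Q" using h O by simp
  then have dc: "d \<cdot> c = idm C Q" using eq_if_diff_zro[OF id_in[OF O(3)] comp_in[OF d c(1)]] by simp
  have ci: "isoC C Q y c" using c d cd dc unfolding isoC_def by blast
  show ?thesis
    by (rule Tri_iso_closed[OF t _ _ _ isoC_id isoC_id ci]) (use B c h O in auto)
qed

text \<open>The difference \<open>n = 1 - c\<close> factors through \<open>h\<close> and is killed by it, so \<open>n\<^sup>2 = 0\<close>.\<close>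
lemma triangle_endo_iso:
  assumes "(X,Y,Z,f,g,h) \<in> Tri C" "c \<in> Hom C Z Z" "c \<cdot> g = g" "h \<cdot> c = h"
  obtains e where "e \<in> Hom C Z Z" "e \<cdot> c = idm C Z"
proof -
  note O = Tri_Ob[OF assms(1)] and H = Tri_Hom[OF assms(1)]
  define n where "n = idm C Z \<^bold>+ ngt C c"
  have n: "n \<in> Hom C Z Z" using assms O n_def by blast
  have "n \<cdot> g = zro C Y Z"
    using comp_diff_left[OF H(2) id_in assms(2)] pls_ngt[OF H(2)] assms(3) H O by (simp add: n_def)
  then obtain k where k: "k \<in> Hom C (SO C X) Z" "k \<cdot> h = n"
    using Tri_weak_cokernel[OF Tri_rot[OF assms(1)] n] by blast
  have "h \<cdot> n = zro C Z (SO C X)"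
    using comp_diff_right[OF id_in assms(2) H(3)] pls_ngt[OF H(3)] assms(4) H O by (simp add: n_def)
  then have nn: "n \<cdot> n = zro C Z Z" using comp_assoc[OF n H(3) k(1)] k O by simp
  have "n \<^bold>+ c = idm C Z"
    using diff_pls[OF id_in assms(2)] n_def O by simp
  then have "n \<cdot> n \<^bold>+ n \<cdot> c = n" using comp_pls_right[OF n assms(2) n] n by simp
  then have nc: "n \<cdot> c = n" using nn zro_pls[OF comp_in[OF n assms(2)]] by simp
  \<comment> \<open>As \<open>c = 1 - n\<close> with \<open>n\<close> of square zero, the geometric
    series for its inverse stops at \<open>1 + n\<close>.\<close>
  have "(idm C Z \<^bold>+ n) \<cdot> c = c \<^bold>+ n"
    using comp_pls_left[OF assms(2) id_in n] nc assms(2) O by simp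
  also have "\<dots> = idm C Z" using \<open>n \<^bold>+ c = idm C Z\<close> pls_commute[OF n assms(2)] by simp
  finally show ?thesis using that n O by blast
qed

section \<open>Powers of the suspension as exact functors\<close>

text \<open>The third map of the image triangle is left unspecified, so that no signs have to be tracked.\<close>
definition exact_endo :: "('o \<Rightarrow> 'o) \<Rightarrow> ('m \<Rightarrow> 'm) \<Rightarrow> bool" where
  "exact_endo Fo Fm \<longleftrightarrow>
     (\<forall>x\<in>Ob C. Fo x \<in> Ob C \<and> Fm (idm C x) = idm C (Fo x)) \<and>
     (\<forall>x y f. f \<in> Hom C x y \<longrightarrow> Fm f \<in> Hom C (Fo x) (Fo y)) \<and>
     (\<forall>x y z f g. f \<in> Hom C x y \<longrightarrow> g \<in> Hom C y z \<longrightarrow> Fm (g \<cdot> f) = Fm g \<cdot> Fm f) \<and>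
     (\<forall>X Y Z f g h. (X,Y,Z,f,g,h) \<in> Tri C \<longrightarrow> (\<exists>h'. (Fo X, Fo Y, Fo Z, Fm f, Fm g, h') \<in> Tri C))"

lemma exact_endoD:
  assumes "exact_endo Fo Fm"
  shows "x \<in> Ob C \<Longrightarrow> Fo x \<in> Ob C" "x \<in> Ob C \<Longrightarrow> Fm (idm C x) = idm C (Fo x)"
    "f \<in> Hom C x y \<Longrightarrow> Fm f \<in> Hom C (Fo x) (Fo y)"
    "f \<in> Hom C x y \<Longrightarrow> g \<in> Hom C y z \<Longrightarrow> Fm (g \<cdot> f) = Fm g \<cdot> Fm f"
    "(X,Y,Z,f,g,h) \<in> Tri C \<Longrightarrow> \<exists>h'. (Fo X, Fo Y, Fo Z, Fm f, Fm g, h') \<in> Tri C"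
proof -
  note E = assms[unfolded exact_endo_def]
  note E2 = E[THEN conjunct2]
  note E3 = E2[THEN conjunct2]
  show "x \<in> Ob C \<Longrightarrow> Fo x \<in> Ob C" "x \<in> Ob C \<Longrightarrow> Fm (idm C x) = idm C (Fo x)"
    using E[THEN conjunct1] by blast+
  show "f \<in> Hom C x y \<Longrightarrow> Fm f \<in> Hom C (Fo x) (Fo y)"
    using E2[THEN conjunct1] by blast
  show "f \<in> Hom C x y \<Longrightarrow> g \<in> Hom C y z \<Longrightarrow> Fm (g \<cdot> f) = Fm g \<cdot> Fm f"
    using E3[THEN conjunct1] by blast
  show "(X,Y,Z,f,g,h) \<in> Tri C \<Longrightarrow> \<exists>h'. (Fo X, Fo Y, Fo Z, Fm f, Fm g, h') \<in> Tri C"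
    using E3[THEN conjunct2] by blast
qed

lemma isoC_ngt_id:
  assumes "x \<in> Ob C"
  shows "isoC C x x (ngt C (idm C x))"
proof -
  have "ngt C (idm C x) \<cdot> ngt C (idm C x) = idm C x"
    using assms by (metis comp_ngt_right id_in id_right ngt_in ngt_ngt)
  then show ?thesis using assms unfolding isoC_def by blast
qed

text \<open>Minus the identity on the middle object, with identities at the ends, is an isomorphism
  between the two triangles.\<close>

lemma Tri_signs:
  assumes "(X,Y,Z,f,g,h) \<in> Tri C"
  shows "(X,Y,Z,ngt C f,ngt C g,h) \<in> Tri C"
proof -
  note O = Tri_Ob[OF assms] and H = Tri_Hom[OF assms]
  show ?thesis
  proof (rule Tri_iso_closed[OF assms _ _ _ isoC_id isoC_ngt_id isoC_id])
    show "ngt C (idm C Y) \<cdot> f = ngt C f \<cdot> idm C X"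
      using O H by (metis comp_ngt_left id_in id_left id_right ngt_in)
    show "idm C Z \<cdot> g = ngt C g \<cdot> ngt C (idm C Y)"
      using O H by (metis comp_ngt_right id_in id_left id_right ngt_in ngt_ngt)
  qed (use O H in auto)
qed

text \<open>Three rotations suspend a triangle and negate all three maps; \<open>Tri_signs\<close>
  removes two of the signs.\<close>

lemma Tri_susp_iff:
  assumes "f \<in> Hom C X Y" "g \<in> Hom C Y Z"
  shows "(X,Y,Z,f,g,h) \<in> Tri C \<longleftrightarrow>
    (SO C X, SO C Y, SO C Z, SM C f, SM C g, ngt C (SM C h)) \<in> Tri C"
proof -
  have "(X,Y,Z,f,g,h) \<in> Tri C \<longleftrightarrow>
    (SO C X, SO C Y, SO C Z, ngt C (SM C f), ngt C (SM C g), ngt C (SM C h)) \<in> Tri C"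
    by (metis Tri_rot_iff)
  also have "\<dots> \<longleftrightarrow> (SO C X, SO C Y, SO C Z, SM C f, SM C g, ngt C (SM C h)) \<in> Tri C"
    using assms by (metis SM_in Tri_signs ngt_ngt)
  finally show ?thesis .
qed

lemma exact_endo_SO: "exact_endo (SO C) (SM C)"
  unfolding exact_endo_def
proof (intro conjI allI impI)
  fix X Y Z f g h assume t: "(X,Y,Z,f,g,h) \<in> Tri C"
  show "\<exists>h'. (SO C X, SO C Y, SO C Z, SM C f, SM C g, h') \<in> Tri C"
    using t Tri_susp_iff[OF Tri_Hom(1,2)[OF t]] by blast
qed (use SM_comp in auto)

lemma exact_endo_SOi: "exact_endo (SOi C) (SMi C)"
  unfolding exact_endo_def
proof (intro conjI allI impI)
  fix X Y Z f g h assume t: "(X,Y,Z,f,g,h) \<in> Tri C"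
  note O = Tri_Ob[OF t] and H = Tri_Hom[OF t]
  have "SMi C h \<in> Hom C (SOi C Z) X" using SMi_in[OF H(3)] O by simp
  then have "ngt C (SM C (ngt C (SMi C h))) = h"
    using H(3) by (metis SM_SMi SM_ngt ngt_ngt)
  then have "(SOi C X, SOi C Y, SOi C Z, SMi C f, SMi C g, ngt C (SMi C h)) \<in> Tri C"
    using t O H by (subst Tri_susp_iff[OF SMi_in[OF H(1)] SMi_in[OF H(2)]]) simp
  then show "\<exists>h'. (SOi C X, SOi C Y, SOi C Z, SMi C f, SMi C g, h') \<in> Tri C" by blast
qed (use SMi_comp SMi_id in auto)

lemma exact_endo_funpow:
  assumes "exact_endo Fo Fm"
  shows "exact_endo (Fo ^^ n) (Fm ^^ n)"
proof (induction n)
  case 0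
  then show ?case by (auto simp: exact_endo_def)
next
  case (Suc n)
  have "\<exists>h'. ((Fo ^^ Suc n) X, (Fo ^^ Suc n) Y, (Fo ^^ Suc n) Z, (Fm ^^ Suc n) f, (Fm ^^ Suc n) g, h') \<in> Tri C"
    if t: "(X,Y,Z,f,g,h) \<in> Tri C" for X Y Z f g h
  proof -
    obtain h' where "((Fo ^^ n) X, (Fo ^^ n) Y, (Fo ^^ n) Z, (Fm ^^ n) f, (Fm ^^ n) g, h') \<in> Tri C"
      using exact_endoD(5)[OF Suc t] by blast
    then show ?thesis using exact_endoD(5)[OF assms] by simp
  qed
  moreover have "(Fm ^^ Suc n) (g \<cdot> f) = (Fm ^^ Suc n) g \<cdot> (Fm ^^ Suc n) f"
    if "f \<in> Hom C x y" "g \<in> Hom C y z" for x y z f g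
    using exact_endoD(4)[OF Suc that] exact_endoD(4)[OF assms exact_endoD(3)[OF Suc that(1)] exact_endoD(3)[OF Suc that(2)]]
    by simp
  ultimately show ?case
    using exact_endoD(1-3)[OF assms] exact_endoD(1-3)[OF Suc] unfolding exact_endo_def by simp
qed

lemma exact_endo_SOp: "exact_endo (SOp C d) (SMp C d)"
proof (cases "0 \<le> d")
  case True
  then have "SOp C d = SO C ^^ nat d" "SMp C d = SM C ^^ nat d"
    by (auto simp: SOp_def SMp_def)
  then show ?thesis using exact_endo_funpow[OF exact_endo_SO] by simp
next
  case False
  then have "SOp C d = SOi C ^^ nat (- d)" "SMp C d = SMi C ^^ nat (- d)"
    by (auto simp: SOp_def SMp_def)
  then show ?thesis using exact_endo_funpow[OF exact_endo_SOi] by simp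
qed

lemma SOp_Ob: "x \<in> Ob C \<Longrightarrow> SOp C d x \<in> Ob C"
  and SMp_id: "x \<in> Ob C \<Longrightarrow> SMp C d (idm C x) = idm C (SOp C d x)"
  and SMp_in: "f \<in> Hom C x y \<Longrightarrow> SMp C d f \<in> Hom C (SOp C d x) (SOp C d y)"
  and SMp_comp: "f \<in> Hom C x y \<Longrightarrow> g \<in> Hom C y z \<Longrightarrow> SMp C d (g \<cdot> f) = SMp C d g \<cdot> SMp C d f"
  using exact_endoD(1-4)[OF exact_endo_SOp[of d]] by blast+

lemma Tri_SOp:
  assumes "(X,Y,Z,f,g,h) \<in> Tri C"
  obtains h' where "(SOp C d X, SOp C d Y, SOp C d Z, SMp C d f, SMp C d g, h') \<in> Tri C"
  using exact_endoD(5)[OF exact_endo_SOp assms] by blast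

section \<open>Levels of cones\<close>

lemma thick1_SOp:
  assumes "Y \<in> thick1 C X"
  shows "SOp C d Y \<in> thick1 C X"
proof -
  have "(SO C ^^ n) Y \<in> thick1 C X" "(SOi C ^^ n) Y \<in> thick1 C X" for n
    by (induction n) (auto intro: assms thick1.susp thick1.desusp)
  then show ?thesis by (simp add: SOp_def)
qed

text \<open>Replaces the biproduct decomposition in \<open>thick\<close> by a retraction, with
  \<open>split_mono_complement\<close> supplying the other summand.\<close>

lemma thick_SucI:
  assumes "(Y1,B,Y2,a,b,c) \<in> Tri C" "Y1 \<in> thick1 C X" "Y2 \<in> thick C X (Suc n)"
    and "i \<in> Hom C Y B" "p \<in> Hom C B Y" "p \<cdot> i = idm C Y"
  shows "Y \<in> thick C X (Suc (Suc n))"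
proof -
  obtain Q j r q where "is_biprod C B Y Q i j r q"
    using assms(4-6) by (rule split_mono_complement)
  then show ?thesis using assms(1-3) Hom_dom[OF assms(4)] unfolding thick.simps by blast
qed

text \<open>The extra component into \<open>A'\<close> is what lets the induction close: in the
  step, the hypothesis is applied to \<open>Y2\<close> with the connecting map \<open>c\<close> into
  \<open>SO C Y1\<close> as second component.\<close>

lemma thick_cone_pair:
  assumes \<alpha>_in: "\<And>x. x \<in> Ob C \<Longrightarrow> \<alpha> x \<in> Hom C x (SOp C d x)"
    and \<alpha>_nat: "\<And>x y f. f \<in> Hom C x y \<Longrightarrow> \<alpha> y \<cdot> f = SMp C d f \<cdot> \<alpha> x"
    and "A \<in> thick C X (Suc n)" "A' \<in> thick1 C X" "is_biprod C P (SOp C d A) A' i1 i2 p1 p2"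
    and "(A,P,W,m,g,h) \<in> Tri C" "p1 \<cdot> m = \<alpha> A"
  shows "W \<in> thick C X (Suc (Suc n))"
  using assms(3-)
proof (induction n arbitrary: A A' P i1 i2 p1 p2 W m g h)
  case 0
  \<comment> \<open>The rotated triangle makes \<open>W\<close> an extension of
    \<open>SO C A\<close> by \<open>P\<close>, both of level at most one, so the retraction can be
    the identity.\<close>
  note t = Tri_rot[OF "0.prems"(4)] and W = Tri_Ob(3)[OF "0.prems"(4)]
  have "P \<in> thick1 C X" "SO C A \<in> thick1 C X"
    using 0 by (auto intro: thick1.sum thick1_SOp thick1.susp)
  then show ?case using thick_SucI[OF t, of X 0 "idm C W" W "idm C W"] W id_left[OF id_in[OF W]] by simp
next
  case (Suc n)
  note tW = \<open>(A,P,W,m,g,h) \<in> Tri C\<close>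
  note P = biprodD[OF \<open>is_biprod C P (SOp C d A) A' i1 i2 p1 p2\<close>]
  note m = Tri_Hom(1)[OF tW]
  obtain At B j1 j2 q1 q2 Y1 Y2 a b c where bp: "is_biprod C B A At j1 j2 q1 q2"
    and Y1: "Y1 \<in> thick1 C X" and Y2: "Y2 \<in> thick C X (Suc n)" and tB: "(Y1,B,Y2,a,b,c) \<in> Tri C"
    using Suc.prems(1) unfolding thick.simps by blast
  note B = biprodD[OF bp] and O = Tri_Ob[OF tB] and H = Tri_Hom[OF tB]
  define t where "t = \<alpha> Y2 \<cdot> b"
  have t: "t \<in> Hom C B (SOp C d Y2)" using \<alpha>_in[OF O(3)] H unfolding t_def by blast
  \<comment> \<open>\<open>V\<close> is chosen as a cone of the map with components
    \<open>\<alpha> Y2\<close> and \<open>c\<close>, which bounds its level by induction. It remains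
    to see that it is also a cone of \<open>t\<close>.\<close>
  obtain V e f where V: "V \<in> thick C X (Suc (Suc n))" and tV: "(B, SOp C d Y2, V, t, e, f) \<in> Tri C"
  proof -
    obtain P2 k1 k2 r1 r2 where bp2: "is_biprod C P2 (SOp C d Y2) (SO C Y1) k1 k2 r1 r2"
      using biprod_exists SOp_Ob O by (metis SO_Ob)
    note P2 = biprodD[OF bp2]
    obtain m2 where m2: "m2 \<in> Hom C Y2 P2" "r1 \<cdot> m2 = \<alpha> Y2" "r2 \<cdot> m2 = c"
      using biprod_pair[OF bp2 \<alpha>_in[OF O(3)] H(3)] .
    obtain V g2 h2 where t2: "(Y2,P2,V,m2,g2,h2) \<in> Tri C" using m2(1) by (rule Tri_cone)
    have V: "V \<in> thick C X (Suc (Suc n))"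
      using Suc.IH[OF Y2 thick1.susp[OF Y1] bp2 t2 m2(2)] .
    \<comment> \<open>Octahedron on \<open>r2 \<cdot> m2 = c\<close>: the cones of
      \<open>m2\<close>, \<open>r2\<close> and \<open>c\<close> are \<open>V\<close>,
      \<open>SO C (SOp C d Y2)\<close> and \<open>SO C B\<close>. The second equation serves to
      identify \<open>g'\<close>.\<close>
    obtain f g' where oct: "(V, SO C B, SO C (SOp C d Y2), f, g', SM C g2 \<cdot> ngt C (SM C k1)) \<in> Tri C"
      "SM C m2 \<cdot> ngt C (SM C b) = ngt C (SM C k1) \<cdot> g'"
      by (rule octahedral[OF t2 Tri_rot[OF biprod_Tri[OF bp2]], unfolded m2(3), OF Tri_rot[OF Tri_rot[OF tB]]])
    note g' = Tri_Hom(2)[OF oct(1)]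
    have b: "SM C b \<in> Hom C (SO C B) (SO C Y2)" and k1: "SM C k1 \<in> Hom C (SO C (SOp C d Y2)) (SO C P2)"
      and r1: "SM C r1 \<in> Hom C (SO C P2) (SO C (SOp C d Y2))" and m2': "SM C m2 \<in> Hom C (SO C Y2) (SO C P2)"
      using H P2 m2 by blast+
    have "ngt C (SM C k1 \<cdot> g') = ngt C (SM C m2 \<cdot> SM C b)"
      using oct(2) comp_ngt_right[OF b m2'] comp_ngt_left[OF g' k1] by simp
    then have eq: "SM C k1 \<cdot> g' = SM C m2 \<cdot> SM C b"
      using ngt_ngt[OF comp_in[OF k1 g']] ngt_ngt[OF comp_in[OF m2' b]] by metis
    \<comment> \<open>\<open>SM C r1\<close> cancels \<open>SM C k1\<close> on one side and turns
      \<open>m2\<close> into \<open>\<alpha> Y2\<close> on the other, so \<open>g'\<close> is the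
      suspension of \<open>t\<close>.\<close>
    have "g' = SM C r1 \<cdot> (SM C k1 \<cdot> g')"
      using comp_assoc[OF g' k1 r1] SM_comp[OF P2(4,6), symmetric] P2(2,8) g' by simp
    also have "\<dots> = SM C t"
      unfolding eq t_def using comp_assoc[OF b m2' r1] SM_comp[OF m2(1) P2(6)] m2(2)
        SM_comp[OF H(2) \<alpha>_in[OF O(3)]] by simp
    finally have "(SO C B, SO C (SOp C d Y2), SO C V, SM C t, SM C g2 \<cdot> ngt C (SM C k1), ngt C (SM C f)) \<in> Tri C"
      using Tri_rot[OF oct(1)] by simp
    \<comment> \<open>The second map is rewritten as a suspension so that the whole triangle can be
      desuspended.\<close>
    moreover have e: "SM C g2 \<cdot> ngt C (SM C k1) = SM C (ngt C (g2 \<cdot> k1))" "ngt C (g2 \<cdot> k1) \<in> Hom C (SOp C d Y2) V"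
    proof -
      note g2 = Tri_Hom(2)[OF t2]
      show "ngt C (g2 \<cdot> k1) \<in> Hom C (SOp C d Y2) V" using g2 P2(4) by blast
      show "SM C g2 \<cdot> ngt C (SM C k1) = SM C (ngt C (g2 \<cdot> k1))"
        using comp_ngt_right[OF k1 SM_in[OF g2]] SM_ngt[OF comp_in[OF g2 P2(4)]] SM_comp[OF P2(4) g2] by simp
    qed
    ultimately have "(B, SOp C d Y2, V, t, ngt C (g2 \<cdot> k1), f) \<in> Tri C"
      using Tri_susp_iff[OF t e(2)] by simp
    then show ?thesis using that V by blast
  qed
  \<comment> \<open>The triangle \<open>tB\<close> has \<open>B\<close> in the middle, and
    \<open>A\<close> is only a summand of \<open>B\<close>. So a map \<open>mB\<close> out of
    \<open>B\<close> is built in analogy with \<open>m\<close>, its second component being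
    precomposed with the projection \<open>q1\<close>. The cone \<open>W\<close> will be a retract
    of the cone \<open>WB\<close> of \<open>mB\<close>.\<close>
  obtain PB k1 k2 r1 r2 where bpB: "is_biprod C PB (SOp C d B) A' k1 k2 r1 r2"
    using biprod_exists SOp_Ob O(2) P(3) by metis
  note PB = biprodD[OF bpB]
  have u: "p2 \<cdot> m \<in> Hom C A A'" using P(7) m by blast
  obtain mB where mB: "mB \<in> Hom C B PB" "r1 \<cdot> mB = \<alpha> B" "r2 \<cdot> mB = p2 \<cdot> m \<cdot> q1"
    using biprod_pair[OF bpB \<alpha>_in[OF O(2)] comp_in[OF u B(6)]] .
  obtain WB gB hB where tWB: "(B,PB,WB,mB,gB,hB) \<in> Tri C" using mB(1) by (rule Tri_cone)
  have b': "SMp C d b \<in> Hom C (SOp C d B) (SOp C d Y2)" using SMp_in[OF H(2)] .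
  \<comment> \<open>By naturality of \<open>\<alpha>\<close> along \<open>b\<close>, the composite
    \<open>v \<cdot> mB\<close> is \<open>t\<close>, whose cone is \<open>V\<close>.\<close>
  define v where "v = SMp C d b \<cdot> r1"
  have v: "v \<in> Hom C PB (SOp C d Y2)" using b' PB(6) v_def by blast
  have "v \<cdot> mB = t"
    using comp_assoc[OF mB(1) PB(6) b'] mB(2) \<alpha>_nat[OF H(2)] by (simp add: v_def t_def)
  then have tV': "(B, SOp C d Y2, V, v \<cdot> mB, e, f) \<in> Tri C" using tV by simp
  obtain E l i where tE: "(PB, SOp C d Y2, E, v, l, i) \<in> Tri C" using v by (rule Tri_cone)
  \<comment> \<open>Octahedron on the factorization of \<open>v\<close> through \<open>r1\<close>:
    the cones of the two factors are \<open>SO C A'\<close> and \<open>SO C (SOp C d Y1)\<close>.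
    The connecting map between them has the suspension of a zero map as a factor, so
    \<open>E\<close> is their biproduct.\<close>
  have E: "E \<in> thick1 C X"
  proof -
    obtain h' where "(SOp C d Y1, SOp C d B, SOp C d Y2, SMp C d a, SMp C d b, h') \<in> Tri C"
      using tB by (rule Tri_SOp)
    note tb = Tri_rot[OF this]
    obtain f g where "(SO C A', E, SO C (SOp C d Y1), f, g,
        SM C (zro C (SOp C d B) (SO C A')) \<cdot> ngt C (SM C (SMp C d a))) \<in> Tri C"
      by (rule octahedral[OF Tri_rot[OF biprod_Tri[OF biprod_swap[OF bpB]]] tb tE[unfolded v_def]])
    moreover have "SM C (zro C (SOp C d B) (SO C A')) \<cdot> ngt C (SM C (SMp C d a))
        = zro C (SO C (SOp C d Y1)) (SO C (SO C A'))"
      using zro_comp[OF Tri_Hom(3)[OF tb]] P(3) PB(2) by simp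
    ultimately obtain r s where "is_biprod C E (SO C A') (SO C (SOp C d Y1)) f s r g"
      using Tri_split by metis
    then show ?thesis
      using thick1.sum[OF thick1.susp[OF Suc.prems(2)] thick1.susp[OF thick1_SOp[OF Y1]]] by blast
  qed
  \<comment> \<open>Octahedron on \<open>v \<cdot> mB = t\<close>. Rotated backwards, it presents
    \<open>WB\<close> as an extension of \<open>V\<close> by \<open>SOi C E\<close>.\<close>
  obtain f1 g1 h1 where "(WB, V, E, f1, g1, h1) \<in> Tri C"
    using octahedral[OF tWB tE tV'] by metis
  note tWB' = Tri_rot_back[OF this]
  have j: "SMp C d j1 \<in> Hom C (SOp C d A) (SOp C d B)" and q: "SMp C d q1 \<in> Hom C (SOp C d B) (SOp C d A)"
    using SMp_in B(4,6) by blast+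
  \<comment> \<open>\<open>\<beta>\<close> and \<open>\<gamma>\<close> act by \<open>j1\<close> and
    \<open>q1\<close>, shifted by \<open>d\<close>, on the first summand and by the identity on
    \<open>A'\<close>. With \<open>j1\<close> and \<open>q1\<close> they make \<open>m\<close> a
    retract of \<open>mB\<close>.\<close>
  obtain \<beta> where \<beta>: "\<beta> \<in> Hom C P PB" "r1 \<cdot> \<beta> = SMp C d j1 \<cdot> p1" "r2 \<cdot> \<beta> = p2"
    using biprod_pair[OF bpB comp_in[OF j P(6)] P(7)] .
  obtain \<gamma> where \<gamma>: "\<gamma> \<in> Hom C PB P" "p1 \<cdot> \<gamma> = SMp C d q1 \<cdot> r1" "p2 \<cdot> \<gamma> = r2"
    using biprod_pair[OF Suc.prems(3) comp_in[OF q PB(6)] PB(7)] .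
  have "\<beta> \<cdot> m = mB \<cdot> j1"
  proof (rule biprod_eqI[OF bpB])
    show "r1 \<cdot> (\<beta> \<cdot> m) = r1 \<cdot> (mB \<cdot> j1)"
      using comp_assoc[OF m \<beta>(1) PB(6)] comp_assoc[OF B(4) mB(1) PB(6)] comp_assoc[OF m P(6) j]
        \<beta>(2) mB(2) Suc.prems(5) \<alpha>_nat[OF B(4)] by simp
    show "r2 \<cdot> (\<beta> \<cdot> m) = r2 \<cdot> (mB \<cdot> j1)"
      using comp_assoc[OF m \<beta>(1) PB(7)] comp_assoc[OF B(4) mB(1) PB(7)] comp_assoc[OF B(4,6) u]
        \<beta>(3) mB(3) B(8) u by simp
  qed (use \<beta> m mB B in blast)+
  then obtain c1 where c1: "c1 \<in> Hom C W WB" "c1 \<cdot> g = gB \<cdot> \<beta>" "SM C j1 \<cdot> h = hB \<cdot> c1"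
    using Tri_map[OF tW tWB B(4) \<beta>(1)] by blast
  have "\<gamma> \<cdot> mB = m \<cdot> q1"
  proof (rule biprod_eqI[OF Suc.prems(3)])
    show "p1 \<cdot> (\<gamma> \<cdot> mB) = p1 \<cdot> (m \<cdot> q1)"
      using comp_assoc[OF mB(1) \<gamma>(1) P(6)] comp_assoc[OF B(6) m P(6)] comp_assoc[OF mB(1) PB(6) q]
        \<gamma>(2) mB(2) Suc.prems(5) \<alpha>_nat[OF B(6)] by simp
    show "p2 \<cdot> (\<gamma> \<cdot> mB) = p2 \<cdot> (m \<cdot> q1)"
      using comp_assoc[OF mB(1) \<gamma>(1) P(7)] comp_assoc[OF B(6) m P(7)] \<gamma>(3) mB(3) by simp
  qed (use \<gamma> m mB B in blast)+
  then obtain c2 where c2: "c2 \<in> Hom C WB W" "c2 \<cdot> gB = g \<cdot> \<gamma>" "SM C q1 \<cdot> hB = h \<cdot> c2"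
    using Tri_map[OF tWB tW B(6) \<gamma>(1)] by blast
  have "\<gamma> \<cdot> \<beta> = idm C P"
  proof (rule biprod_eqI[OF Suc.prems(3)])
    have "SMp C d q1 \<cdot> SMp C d j1 = idm C (SOp C d A)"
      using SMp_comp[OF B(4,6)] SMp_id[OF B(2)] B(8) by simp
    then show "p1 \<cdot> (\<gamma> \<cdot> \<beta>) = p1 \<cdot> idm C P"
      using comp_assoc[OF \<beta>(1) \<gamma>(1) P(6)] comp_assoc[OF \<beta>(1) PB(6) q] comp_assoc[OF P(6) j q]
        \<gamma>(2) \<beta>(2) P(6) by simp
    show "p2 \<cdot> (\<gamma> \<cdot> \<beta>) = p2 \<cdot> idm C P"
      using comp_assoc[OF \<beta>(1) \<gamma>(1) P(7)] \<gamma>(3) \<beta>(3) P(7) by simp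
  qed (use \<gamma> \<beta> P in blast)+
  note gW = Tri_Hom(2,3)[OF tW] and gB = Tri_Hom(2,3)[OF tWB]
  \<comment> \<open>Fill-ins are not functorial, so \<open>c2 \<cdot> c1\<close> need not be the
    identity. It does fix \<open>g\<close> and \<open>h\<close>, hence has a left inverse
    \<open>e'\<close>, and \<open>e' \<cdot> c2\<close> is a retraction of
    \<open>c1\<close>.\<close>
  have "c2 \<cdot> c1 \<cdot> g = g"
    using comp_assoc[OF gW(1) c1(1) c2(1)] comp_assoc[OF \<beta>(1) gB(1) c2(1)] comp_assoc[OF \<beta>(1) \<gamma>(1) gW(1)]
      c1(2) c2(2) \<open>\<gamma> \<cdot> \<beta> = idm C P\<close> gW(1) by simp
  moreover have "h \<cdot> (c2 \<cdot> c1) = h"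
    using comp_assoc[OF c1(1) c2(1) gW(2)] comp_assoc[OF c1(1) gB(2) SM_in[OF B(6)]]
      comp_assoc[OF gW(2) SM_in[OF B(4)] SM_in[OF B(6)]] c1(3) c2(3) SM_comp[OF B(4,6), symmetric] B(2,8) gW(2) by simp
  ultimately obtain e' where e': "e' \<in> Hom C W W" "e' \<cdot> (c2 \<cdot> c1) = idm C W"
    using triangle_endo_iso[OF tW comp_in[OF c2(1) c1(1)]] by blast
  have "e' \<cdot> c2 \<cdot> c1 = idm C W" using e' comp_assoc[OF c1(1) c2(1) e'(1)] by simp
  then show ?case
    using thick_SucI[OF tWB' thick1.desusp[OF E] V c1(1) comp_in[OF e'(1) c2(1)]] by blast
qed

section \<open>Koszul objects on one element and on a sequence\<close>

lemma thick_Koszul_step: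
  assumes "central C d \<alpha>" "A \<in> thick C X n" and t: "(A, SOp C d A, L, \<alpha> A, g, h) \<in> Tri C"
  shows "L \<in> thick C X (Suc n)"
proof (cases n)
  case 0
  note O = Tri_Ob[OF t] and H = Tri_Hom[OF t]
  have z: "is_zero C A" using assms(2) 0 by simp
  have "zro C A A = idm C A" using Hom_zero_source[OF z id_in[OF O(1)]] by simp
  \<comment> \<open>Here \<open>A\<close> itself serves as the zero object of the trivial triangle.
    In the image of this triangle under the shift by \<open>d\<close>, the first two maps are
    identities with composite zero, so \<open>SOp C d A\<close> is zero as well.\<close>
  then have "(A, A, A, idm C A, idm C A, zro C A (SO C A)) \<in> Tri C" using Tri_id[OF O(1) z] by simp
  then obtain h' where "(SOp C d A, SOp C d A, SOp C d A, idm C (SOp C d A), idm C (SOp C d A), h') \<in> Tri C"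
    using Tri_SOp SMp_id[OF O(1)] by metis
  from Tri_comp_zro[OF this] have "idm C (SOp C d A) = zro C (SOp C d A) (SOp C d A)"
    using id_left[OF id_in[OF O(2)]] by simp
  then have "g = zro C (SOp C d A) L" using id_right[OF H(2)] comp_zro[OF H(2) O(2)] by simp
  \<comment> \<open>Since \<open>g\<close> vanishes, the identity of \<open>L\<close> factors
    through \<open>h\<close>, and \<open>L\<close> is a retract of \<open>SO C A\<close>.\<close>
  then have "idm C L \<cdot> g = zro C (SOp C d A) L" using O by simp
  then obtain k where "k \<in> Hom C (SO C A) L" "k \<cdot> h = idm C L"
    using Tri_weak_cokernel[OF Tri_rot[OF t] id_in[OF O(3)]] by blast
  then have "L \<in> thick1 C X"
    using thick1.retr[OF thick1.susp[OF thick1.zero[OF z]] O(3) H(3)] by blast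
  then show ?thesis using 0 by simp
next
  case (Suc k)
  obtain z where z: "is_zero C z" by (rule zero_exists)
  note O = Tri_Ob[OF t] and H = Tri_Hom[OF t]
  show ?thesis unfolding Suc
  \<comment> \<open>The biproduct is \<open>SOp C d A\<close> plus a zero object, with the identity
    as first projection.\<close>
  proof (rule thick_cone_pair[OF _ _ _ thick1.zero[OF z] biprod_zero[OF O(2) z] t])
    show "\<alpha> x \<in> Hom C x (SOp C d x)" if "x \<in> Ob C" for x
      using assms(1) that by (simp add: central_def)
    show "\<alpha> y \<cdot> f = SMp C d f \<cdot> \<alpha> x" if "f \<in> Hom C x y" for x y f
      using assms(1) that unfolding central_def by blast
  qed (use assms(2) Suc H in auto)
qed

lemma thick_Koszul:
  assumes "koszul C Y als K" "\<forall>(d, \<alpha>) \<in> set als. central C d \<alpha>" "Y \<in> thick C X n"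
  shows "K \<in> thick C X (n + length als)"
  using assms
proof (induction rule: koszul.induct)
  case nil
  then show ?case by simp
next
  case (snoc as K d L \<alpha> g h)
  then show ?case using thick_Koszul_step[of d \<alpha> K X "n + length as" L g h] by auto
qed

end

section \<open>From membership in \<open>thick\<close> to levels\<close>

theorem theorem4p8:
  fixes T :: "('to,'tm) tcat"
    and acts :: "(('so,'sm) tcat \<times> ('so,'sm) moncat \<times> ('so,'sm,'to,'tm) action) list"
    and als :: "(int \<times> ('to \<Rightarrow> 'tm)) list"
    and X Y K :: 'to
  assumes "triangulated T"
    and "length acts = length als"
    and "\<forall>k < length als. (case acts ! k of (S, M, A) \<Rightarrow>
            monoidal_tri S M \<and> is_action S M T A \<and> strong_verdier S T T (act A) \<and>
            central T (fst (als ! k)) (snd (als ! k)) \<and>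
            induced S M T A (fst (als ! k)) (snd (als ! k)))"
    and "X \<in> Ob T" and "Y \<in> Ob T"
    and "koszul T Y als K"
  shows "level T X K \<le> level T X Y + enat (length als)"
proof -
  interpret triangulated_category T by unfold_locales (rule assms(1))
  have central: "\<forall>(d, \<alpha>) \<in> set als. central T d \<alpha>"
  proof (clarify, unfold in_set_conv_nth, clarify)
    fix d \<alpha> k assume "k < length als" "als ! k = (d, \<alpha>)"
    then show "central T d \<alpha>" using assms(3)[rule_format, of k] by (simp split: prod.splits)
  qed
  show ?thesis
  proof (cases "\<exists>n. Y \<in> thick T X n")
    case True
    \<comment> \<open>The infimum of a nonempty set in a well-order is attained, so the level of
      \<open>Y\<close> is a number \<open>n\<close> with \<open>Y\<close> in
      \<open>thick T X n\<close>.\<close>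
    then have "level T X Y \<in> enat ` {n. Y \<in> thick T X n}"
      unfolding level_def by (blast intro: wellorder_InfI)
    then obtain n where n: "Y \<in> thick T X n" "level T X Y = enat n" by blast
    have "level T X K \<le> enat (n + length als)"
      unfolding level_def using thick_Koszul[OF assms(6) central n(1)] by (blast intro: INF_lower)
    then show ?thesis using n(2) by simp
  next
    case False
    \<comment> \<open>The infimum over the empty set is infinite, so the right-hand side is
      infinite.\<close>
    then show ?thesis by (simp add: level_def top_enat_def)
  qed
qed

end
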